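(* Let $\Omega=\Omega_+\setminus\overline{\Omega_-}\subset\mathbb{R}^2$ be an annulus and let $f\in\mathcal{M}(\partial\Omega)$ be a finite signed measure with $f(\partial\Omega_+)=f(\partial\Omega_-)=0$, with positive and negative parts $f^+$ and $f^-$. Suppose that all the transport rays between $f^+$ and $f^-$ are inside the annulus $\Omega$ (i.e. contained in $\overline\Omega$). Let $\gamma$ be an optimal transport plan for $$\text{(K)}\quad \min\Big\{\int_{\overline\Omega\times\overline\Omega}|x-y|\,\mathrm{d}\gamma : \gamma\in\mathcal{M}^+(\overline\Omega\times\overline\Omega),\ (\Pi_x)_\#\gamma=f^+,\ (\Pi_y)_\#\gamma=f^-\Big\},$$ and define the vector measure $w_\gamma$ by $$\langle w_\gamma,\xi\rangle=\int_{\overline\Omega\times\overline\Omega}\int_0^1\xi((1-t)x+ty)\cdot(y-x)\,\mathrm{d}t\,\mathrm{d}\gamma(x,y)\quad\text{for all }\xi\in C(\overline\Omega,\mathbb{R}^2).$$ Then $w_\gamma$ solves the Beckmann problem $$\text{(B)}\quad\min\Big\{\int_{\overline\Omega}|v| : v\in\mathcal{M}(\overline\Omega;\mathbb{R}^2),\ \nabla\cdot v=f\Big\}.$$ Moreover $\min\text{(B)}=\sup\text{(D)}=\min\text{(K)}$, where $$\text{(D)}\quad\sup\Big\{\int_{\overline\Omega}\phi\,\mathrm{d}(f^+-f^-) : \phi\in\mathrm{Lip}_1(\Omega)\Big\}.$$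
   Context: Annulus: $\Omega=\Omega_+\setminus\overline{\Omega_-}$, where $\Omega_\pm\subset\mathbb{R}^2$ are open bounded strictly convex sets with $\Omega_-\subset\subset\Omega_+$. $\mathcal{M}^+$, $\mathcal{M}$, $\mathcal{M}(\cdot;\mathbb{R}^2)$ denote finite nonnegative, signed, and $\mathbb{R}^2$-valued Borel measures; $\Pi_x,\Pi_y$ are the two coordinate projections; $\mathrm{Lip}_1(\Omega)$ is the set of functions which are $1$-Lipschitz with respect to the Euclidean distance (extended to $\overline\Omega$). In (B) the condition $\nabla\cdot v=f$ means $\int_{\overline\Omega}\nabla\phi\cdot\mathrm{d}v=\int_{\partial\Omega}\phi\,\mathrm{d}f$ for every $\phi\in C^1(\overline\Omega)$. (With this paper's sign convention a flow $v$ is opposite in sign to $w_\gamma$ if $w_\gamma$ is tested against gradients with $f=f^+-f^-$; the identity is to be understood up to this global sign, i.e. up to exchanging $v$ and $-v$, which does not change $\int|v|$.) A Kantorovich potential is a maximizer $\phi$ of (D). A transport ray is any maximal segment $[x,y]$ satisfying $\phi(x)-\phi(y)=|x-y|$; here, as transport rays between $f^+$ and $f^-$, $x\in\operatorname{spt}(f^+)$ and $y\in\operatorname{spt}(f^-)$. *)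

theory Defs
  imports "HOL-Analysis.Analysis"
begin

definition strictly_convex :: "'a::euclidean_space set \<Rightarrow> bool" where
  "strictly_convex S \<longleftrightarrow>
     (\<forall>x\<in>closure S. \<forall>y\<in>closure S. x \<noteq> y \<longrightarrow> open_segment x y \<subseteq> interior S)"

text \<open>
  Throughout, a measure on a Borel set \<open>S\<close> is a Borel measure on the whole space that is concentrated
  on \<open>S\<close>; a measure on a boundary is thereby also a measure on the closure. Signed and vector
  measures are finite, countably additive set functions on the Borel sets. They are set to 0 on
  non-Borel sets, so that equality of measures is equality of functions.
\<close>

definition vmeasures_on :: "'a::topological_space set \<Rightarrow> ('a set \<Rightarrow> 'b::real_normed_vector) set" where
  "vmeasures_on S = {\<mu>.
     (\<forall>A. range A \<subseteq> sets borel \<longrightarrow> disjoint_family A \<longrightarrow>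
        (\<lambda>n::nat. \<mu> (A n)) sums \<mu> (\<Union>n. A n)) \<and>
     (\<forall>A\<in>sets borel. \<mu> A = \<mu> (A \<inter> S)) \<and>
     (\<forall>A. A \<notin> sets borel \<longrightarrow> \<mu> A = 0)}"

text \<open>The parts of the Jordan decomposition, by their set-wise formula
  \<open>\<mu>\<^sup>+ A = sup {\<mu> B | B \<subseteq> A Borel}\<close>, \<open>\<mu>\<^sup>- = (- \<mu>)\<^sup>+\<close>. The empty set is among the \<open>B\<close>, so that
  truncating negative values by \<^const>\<open>ennreal\<close> does not matter.\<close>

definition pos_part :: "('a::topological_space set \<Rightarrow> real) \<Rightarrow> 'a measure" where
  "pos_part \<mu> = measure_of UNIV (sets borel) (\<lambda>A. SUP B\<in>{B\<in>sets borel. B \<subseteq> A}. ennreal (\<mu> B))"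

definition neg_part :: "('a::topological_space set \<Rightarrow> real) \<Rightarrow> 'a measure" where
  "neg_part \<mu> = pos_part (\<lambda>A. - \<mu> A)"

definition signed_integral :: "'a::topological_space set \<Rightarrow> ('a set \<Rightarrow> real) \<Rightarrow> ('a \<Rightarrow> real) \<Rightarrow> real" where
  "signed_integral S \<mu> g = (LINT x:S|pos_part \<mu>. g x) - (LINT x:S|neg_part \<mu>. g x)"

definition vector_integral ::
    "'a::topological_space set \<Rightarrow> ('a set \<Rightarrow> 'b::euclidean_space) \<Rightarrow> ('a \<Rightarrow> 'b) \<Rightarrow> real" where
  "vector_integral S v \<xi> = (\<Sum>b\<in>Basis. signed_integral S (\<lambda>A. v A \<bullet> b) (\<lambda>x. \<xi> x \<bullet> b))"

definition total_variation ::
    "'a::topological_space set \<Rightarrow> ('a set \<Rightarrow> 'b::real_normed_vector) \<Rightarrow> ereal" where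
  "total_variation S v =
     (SUP P\<in>{P. finite P \<and> P \<subseteq> sets borel \<and> partition_on S P}. ereal (\<Sum>A\<in>P. norm (v A)))"

definition spt :: "'a::topological_space measure \<Rightarrow> 'a set" where
  "spt \<mu> = {x. \<forall>U. open U \<longrightarrow> x \<in> U \<longrightarrow> emeasure \<mu> U > 0}"

definition transport_plans ::
    "'a::euclidean_space set \<Rightarrow> 'a measure \<Rightarrow> 'a measure \<Rightarrow> ('a \<times> 'a) measure set" where
  "transport_plans K \<mu> \<nu> = {\<gamma>. finite_measure \<gamma> \<and> sets \<gamma> = sets borel \<and>
     emeasure \<gamma> (- (K \<times> K)) = 0 \<and> distr \<gamma> borel fst = \<mu> \<and> distr \<gamma> borel snd = \<nu>}"

definition transport_cost :: "'a::euclidean_space set \<Rightarrow> ('a \<times> 'a) measure \<Rightarrow> ereal" where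
  "transport_cost K \<gamma> = ereal (LINT (x, y):K \<times> K|\<gamma>. dist x y)"

definition Lip1 :: "'a::metric_space set \<Rightarrow> ('a \<Rightarrow> real) set" where
  "Lip1 \<Omega> = {\<phi>. 1-lipschitz_on (closure \<Omega>) \<phi>}"

definition kantorovich_potential ::
    "'a::euclidean_space set \<Rightarrow> ('a set \<Rightarrow> real) \<Rightarrow> ('a \<Rightarrow> real) \<Rightarrow> bool" where
  "kantorovich_potential \<Omega> f \<phi> \<longleftrightarrow>
     is_arg_max (signed_integral (closure \<Omega>) f) (\<lambda>\<phi>. \<phi> \<in> Lip1 \<Omega>) \<phi>"

text \<open>\<open>[x, y]\<close> is a transport ray from \<open>P = spt f\<^sup>+\<close> to \<open>N = spt f\<^sup>-\<close>. Maximality is among the segments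
  that start in \<open>P\<close>, end in \<open>N\<close> and satisfy the equation.\<close>

definition ray_pairs ::
    "('a::euclidean_space \<Rightarrow> real) \<Rightarrow> 'a set \<Rightarrow> 'a set \<Rightarrow> ('a \<times> 'a) set" where
  "ray_pairs \<phi> P N = {(x, y). x \<in> P \<and> y \<in> N \<and> \<phi> x - \<phi> y = dist x y}"

definition transport_ray ::
    "('a::euclidean_space \<Rightarrow> real) \<Rightarrow> 'a set \<Rightarrow> 'a set \<Rightarrow> 'a \<Rightarrow> 'a \<Rightarrow> bool" where
  "transport_ray \<phi> P N x y \<longleftrightarrow> (x, y) \<in> ray_pairs \<phi> P N \<and>
     (\<forall>(x', y')\<in>ray_pairs \<phi> P N.
        closed_segment x y \<subseteq> closed_segment x' y' \<longrightarrow> closed_segment x' y' = closed_segment x y)"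

text \<open>\<open>\<phi> \<in> C\<^sup>1\<close> up to the boundary, with \<open>G\<close> the continuous extension of the gradient to the closure.\<close>

definition C1_closure ::
    "'a::euclidean_space set \<Rightarrow> ('a \<Rightarrow> real) \<Rightarrow> ('a \<Rightarrow> 'a) \<Rightarrow> bool" where
  "C1_closure \<Omega> \<phi> G \<longleftrightarrow> continuous_on (closure \<Omega>) \<phi> \<and> continuous_on (closure \<Omega>) G \<and>
     (\<forall>x\<in>\<Omega>. GDERIV \<phi> x :> G x)"

text \<open>The flows with \<open>\<nabla>\<cdot>v = f\<close>, tested as \<open>\<integral> \<nabla>\<phi> \<cdot> dv = \<integral> \<phi> df\<close> without a minus sign. With this sign,
  flows run from \<open>f\<^sup>-\<close> to \<open>f\<^sup>+\<close>, opposite to the flow of a transport plan from \<open>f\<^sup>+\<close> to \<open>f\<^sup>-\<close>.\<close>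

definition beckmann_flows ::
    "'a::euclidean_space set \<Rightarrow> ('a set \<Rightarrow> real) \<Rightarrow> ('a set \<Rightarrow> 'a) set" where
  "beckmann_flows \<Omega> f = {v \<in> vmeasures_on (closure \<Omega>).
     \<forall>\<phi> G. C1_closure \<Omega> \<phi> G \<longrightarrow>
       vector_integral (closure \<Omega>) v G = signed_integral (frontier \<Omega>) f \<phi>}"

text \<open>The flow \<open>w\<^sub>\<gamma>\<close>, defined by duality with the continuous fields on the compact set \<open>K\<close>. Fields are
  extended by 0 outside \<open>K\<close>, which has no effect when \<open>\<gamma>\<close>-almost every segment \<open>[x, y]\<close> lies in \<open>K\<close>.\<close>

definition plan_flow ::
    "'a::euclidean_space set \<Rightarrow> ('a \<times> 'a) measure \<Rightarrow> 'a set \<Rightarrow> 'a" where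
  "plan_flow K \<gamma> = (THE w. w \<in> vmeasures_on K \<and>
     (\<forall>\<xi>. continuous_on K \<xi> \<longrightarrow> vector_integral K w \<xi> =
        (LINT (x, y):K \<times> K|\<gamma>. LINT t:{0..1}|lborel.
           (let z = (1 - t) *\<^sub>R x + t *\<^sub>R y in (indicator K z *\<^sub>R \<xi> z) \<bullet> (y - x)))))"

end

(*
  Weak duality (D) <= (B): a 1-Lipschitz function is a uniform limit of C^1 functions with gradient
  of norm at most 1, and testing the divergence equation of a flow v with these gives
  \<integral> \<psi> df \<le> \<integral> |v|.

  Conversely, the support of the optimal plan \<gamma> is cyclically monotone, which produces a potential \<psi>
  with \<psi> x - \<psi> y = |x - y| on it; hence \<integral> \<psi> df is the cost of \<gamma>. Comparing the given Kantorovich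
  potential with \<psi>, the pairs (x, y) are \<gamma>-almost everywhere the endpoints of segments of transport
  rays, so these segments stay in the closed annulus. By strict convexity each meets the boundary in
  at most three points. A C^1 test function can therefore be integrated along it, which shows that
  - w_\<gamma> has divergence f. Its total variation is at most the cost of \<gamma>, so all inequalities are equalities.
*)
theory Submission
  imports Defs
begin

section \<open>Signed measures and their Jordan decomposition\<close>

text \<open>Three obstacles shape the proof. Signed and vector measures are bare set functions whose
  integrals are defined through Jordan parts, so integral identities are first rewritten additively,
  as equalities between sums of nonnegative finite measures. Next, \<open>plan_flow\<close> is a
  definite description: it becomes usable only after existence is shown, by pushing forward the plan
  times Lebesgue measure on the unit interval with the displacement as density, and uniqueness, by
  testing with continuous fields. Finally, the hypothesis on rays speaks of one potential
  \<open>\<phi>\<close>, while cyclical monotonicity produces another one. Being a maximizer,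
  \<open>\<phi>\<close> also attains the cost, so its nonnegative slack |x - y| - (\<phi> x - \<phi>
  y) has integral 0 and almost every pair is saturated; such a pair need not be a maximal segment
  and is enlarged to one. Counting boundary points on a segment matters because a test function is
  differentiable only in the open annulus, and the fundamental theorem of calculus tolerates
  finitely many exceptions.\<close>

lemma vmeasures_on_sums:
  assumes "\<mu> \<in> vmeasures_on S" "range A \<subseteq> sets borel" "disjoint_family A"
  shows "(\<lambda>n::nat. \<mu> (A n)) sums \<mu> (\<Union>n. A n)"
  using assms by (auto simp: vmeasures_on_def)

lemma vmeasures_on_Int:
  assumes "\<mu> \<in> vmeasures_on S" "A \<in> sets borel"
  shows "\<mu> (A \<inter> S) = \<mu> A"
  using assms by (auto simp: vmeasures_on_def)

lemma vmeasures_on_not_borel: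
  assumes "\<mu> \<in> vmeasures_on S" "A \<notin> sets borel"
  shows "\<mu> A = 0"
  using assms by (auto simp: vmeasures_on_def)

lemma vmeasures_on_empty:
  assumes "\<mu> \<in> vmeasures_on S"
  shows "\<mu> {} = 0"
proof -
  have "(\<lambda>n::nat. \<mu> {}) sums \<mu> {}"
    using vmeasures_on_sums[OF assms, of "\<lambda>_. {}"] by (simp add: disjoint_family_on_def)
  then have "(\<lambda>n::nat. \<mu> {}) \<longlonglongrightarrow> 0"
    by (intro summable_LIMSEQ_zero sums_summable)
  then show ?thesis
    by (simp add: LIMSEQ_const_iff)
qed

lemma vmeasures_on_Un:
  assumes "\<mu> \<in> vmeasures_on S" "A \<in> sets borel" "B \<in> sets borel" "A \<inter> B = {}"
  shows "\<mu> (A \<union> B) = \<mu> A + \<mu> B"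
proof -
  have "(\<lambda>n. \<mu> (binaryset A B n)) sums \<mu> (\<Union>n. binaryset A B n)"
    using assms
    by (intro vmeasures_on_sums[OF assms(1)])
       (auto simp: disjoint_family_on_def binaryset_def)
  moreover have "(\<lambda>n. \<mu> (binaryset A B n)) sums (\<mu> A + \<mu> B)"
    using vmeasures_on_empty[OF assms(1)] by (rule binaryset_sums)
  ultimately show ?thesis
    by (metis sums_unique2 UN_binaryset_eq)
qed

lemma vmeasures_on_Diff:
  assumes "\<mu> \<in> vmeasures_on S" "A \<in> sets borel" "B \<in> sets borel" "B \<subseteq> A"
  shows "\<mu> (A - B) = \<mu> A - \<mu> B"
proof -
  have "\<mu> (B \<union> (A - B)) = \<mu> B + \<mu> (A - B)"
    using assms by (intro vmeasures_on_Un) auto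
  moreover have "B \<union> (A - B) = A"
    using assms by auto
  ultimately show ?thesis by simp
qed

lemma vmeasures_on_uminus:
  assumes "\<mu> \<in> vmeasures_on S"
  shows "(\<lambda>A. - \<mu> A) \<in> vmeasures_on S"
  using assms by (auto simp: vmeasures_on_def intro!: sums_minus)

lemma vmeasures_on_inner:
  assumes "v \<in> vmeasures_on S"
  shows "(\<lambda>A. v A \<bullet> b) \<in> vmeasures_on S"
  unfolding vmeasures_on_def
proof (intro CollectI conjI allI ballI impI)
  fix A :: "nat \<Rightarrow> 'a set"
  assume "range A \<subseteq> sets borel" "disjoint_family A"
  from vmeasures_on_sums[OF assms this]
  show "(\<lambda>n. v (A n) \<bullet> b) sums (v (\<Union>n. A n) \<bullet> b)"
    by (rule bounded_linear.sums[OF bounded_linear_inner_left])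
qed (simp_all add: vmeasures_on_Int[OF assms] vmeasures_on_not_borel[OF assms])

text \<open>A set with unbounded values on its subsets splits into two parts, one with the same
  defect and the other of measure above 1 in absolute value. Iterating yields disjoint sets whose
  measures do not tend to 0, against countable additivity.\<close>

lemma vmeasures_on_bounded:
  fixes \<mu> :: "'a::topological_space set \<Rightarrow> real"
  assumes "\<mu> \<in> vmeasures_on S"
  obtains C where "\<And>A. \<bar>\<mu> A\<bar> \<le> C"
proof -
  define bad where "bad E \<longleftrightarrow> E \<in> sets borel \<and> \<not> (\<exists>C. \<forall>B\<in>sets borel. B \<subseteq> E \<longrightarrow> \<bar>\<mu> B\<bar> \<le> C)" for E
  have step: "\<exists>E'. bad E' \<and> E' \<subseteq> E \<and> \<bar>\<mu> (E - E')\<bar> > 1" if "bad E" for E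
  proof -
    \<comment> \<open>The margin \<open>\<bar>\<mu> E\<bar> + 1\<close> makes both
      \<open>\<mu> B\<close> and \<open>\<mu> (E - B)\<close> exceed 1 in absolute value, so either
      part may be the one that is split off.\<close>
    from that obtain B where B: "B \<in> sets borel" "B \<subseteq> E" "\<bar>\<mu> B\<bar> > \<bar>\<mu> E\<bar> + 1"
      unfolding bad_def by (meson not_le)
    have E: "E \<in> sets borel" using that by (simp add: bad_def)
    have *: "\<mu> (E - B) = \<mu> E - \<mu> B"
      using vmeasures_on_Diff[OF assms E B(1,2)] .
    have "bad B \<or> bad (E - B)"
    proof (rule ccontr)
      assume "\<not> ?thesis"
      then obtain C D where
        C: "\<And>A. A \<in> sets borel \<Longrightarrow> A \<subseteq> B \<Longrightarrow> \<bar>\<mu> A\<bar> \<le> C" and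
        D: "\<And>A. A \<in> sets borel \<Longrightarrow> A \<subseteq> E - B \<Longrightarrow> \<bar>\<mu> A\<bar> \<le> D"
        using B E unfolding bad_def by (metis sets.Diff)
      have "\<bar>\<mu> A\<bar> \<le> C + D" if A: "A \<in> sets borel" "A \<subseteq> E" for A
      proof -
        have "\<mu> ((A \<inter> B) \<union> (A - B)) = \<mu> (A \<inter> B) + \<mu> (A - B)"
          using A B by (intro vmeasures_on_Un[OF assms]) auto
        moreover have "(A \<inter> B) \<union> (A - B) = A" by auto
        moreover have "\<bar>\<mu> (A \<inter> B)\<bar> \<le> C" using A B by (intro C) auto
        moreover have "\<bar>\<mu> (A - B)\<bar> \<le> D" using A B by (intro D) auto
        ultimately show ?thesis by simp
      qed
      then show False using \<open>bad E\<close> unfolding bad_def by blast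
    qed
    then show ?thesis
    proof
      assume "bad B"
      then show ?thesis using B * by (intro exI[of _ B]) auto
    next
      assume "bad (E - B)"
      moreover have "E - (E - B) = B" using B by auto
      ultimately show ?thesis using B * by (intro exI[of _ "E - B"]) auto
    qed
  qed
  have "\<not> bad UNIV"
  proof
    assume "bad UNIV"
    then have "\<exists>F. \<forall>n::nat. bad (F n) \<and> (F (Suc n) \<subseteq> F n \<and> \<bar>\<mu> (F n - F (Suc n))\<bar> > 1)"
      using step by (intro dependent_nat_choice) auto
    then obtain F where F: "\<And>n. bad (F n)" "\<And>n. F (Suc n) \<subseteq> F n"
        "\<And>n::nat. \<bar>\<mu> (F n - F (Suc n))\<bar> > 1"
      by blast
    have dec: "F n \<subseteq> F m" if "m \<le> n" for m n
      using lift_Suc_antimono_le[of F m n] F(2) that by blast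
    have "disjoint_family (\<lambda>n. F n - F (Suc n))"
    proof -
      have "(F m - F (Suc m)) \<inter> (F n - F (Suc n)) = {}" if "m < n" for m n
        using dec[of "Suc m" n] that by auto
      then show ?thesis
        unfolding disjoint_family_on_def by (metis inf_commute nat_neq_iff)
    qed
    then have "(\<lambda>n. \<mu> (F n - F (Suc n))) sums \<mu> (\<Union>n. F n - F (Suc n))"
      using F(1) by (intro vmeasures_on_sums[OF assms]) (auto simp: bad_def)
    then have "(\<lambda>n. \<mu> (F n - F (Suc n))) \<longlonglongrightarrow> 0"
      by (intro summable_LIMSEQ_zero sums_summable)
    then have "\<forall>\<^sub>F n in sequentially. \<bar>\<mu> (F n - F (Suc n))\<bar> < 1"
      using order_tendstoD(2)[OF tendsto_rabs_zero, of _ _ 1] by force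
    then show False
      using F(3) by (metis (mono_tags, lifting) eventually_happens' less_asym sequentially_bot)
  qed
  then obtain C where C: "\<And>B. B \<in> sets borel \<Longrightarrow> \<bar>\<mu> B\<bar> \<le> C"
    unfolding bad_def by auto
  moreover have "\<bar>\<mu> B\<bar> \<le> C" if "B \<notin> sets borel" for B
    using vmeasures_on_not_borel[OF assms that] C[of "{}"] by simp
  ultimately show thesis
    using that by blast
qed

text \<open>The supremum formula is itself countably additive: competitors for disjoint sets can be
  joined, which gives superadditivity, and a competitor for the union can be cut along the pieces,
  which gives subadditivity.\<close>

lemma emeasure_pos_part:
  assumes \<mu>: "\<mu> \<in> vmeasures_on S" and "A \<in> sets borel"
  shows "emeasure (pos_part \<mu>) A = (SUP B\<in>{B\<in>sets borel. B \<subseteq> A}. ennreal (\<mu> B))"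
    (is "_ = ?p A")
  unfolding pos_part_def
proof (rule emeasure_measure_of_sigma)
  show "sigma_algebra UNIV (sets borel :: 'a set set)"
    using sets.sigma_algebra_axioms[of "borel :: 'a measure"] by simp
  show "positive (sets borel) ?p"
    by (auto simp: positive_def vmeasures_on_empty[OF \<mu>] bot_ennreal)
  show "countably_additive (sets borel) ?p"
  proof (rule countably_additiveI)
    fix A :: "nat \<Rightarrow> 'a set"
    assume A: "range A \<subseteq> sets borel" "disjoint_family A"
    show "(\<Sum>i. ?p (A i)) = ?p (\<Union>i. A i)"
    proof (rule antisym)
      have "(\<Sum>i<n. ?p (A i)) \<le> ?p (\<Union>i. A i)" for n
      proof -
        have "(\<Sum>i\<in>I. ?p (A i)) \<le> ?p (\<Union>i\<in>I. A i)" if "finite I" for I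
          using that
        proof (induction I)
          case (insert i I)
          have dis: "A i \<inter> (\<Union>i\<in>I. A i) = {}"
          proof -
            have "A i \<inter> A j = {}" if "j \<in> I" for j
              using disjoint_family_onD[OF A(2), of i j] insert.hyps(2) that by auto
            then show ?thesis by auto
          qed
          have "?p (A i) + ?p (\<Union>i\<in>I. A i) \<le> ?p (\<Union>i\<in>insert i I. A i)"
          proof -
            have ne: "{B \<in> sets borel. B \<subseteq> X} \<noteq> {}" for X :: "'a set" by auto
            have "ennreal (\<mu> B) + ennreal (\<mu> C) \<le> ?p (\<Union>i\<in>insert i I. A i)"
              if B: "B \<in> sets borel" "B \<subseteq> A i" and C: "C \<in> sets borel" "C \<subseteq> (\<Union>i\<in>I. A i)" for B C
            proof -
              \<comment> \<open>\<open>ennreal\<close> sends negative values to 0, so a competitor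
                of negative measure is replaced by the empty set before joining; otherwise it would
                lower the measure of the union.\<close>
              define B' where "B' = (if \<mu> B \<ge> 0 then B else {})"
              define C' where "C' = (if \<mu> C \<ge> 0 then C else {})"
              have bc: "B' \<in> sets borel" "C' \<in> sets borel" "B' \<inter> C' = {}"
                 "B' \<union> C' \<subseteq> (\<Union>i\<in>insert i I. A i)"
                using B C dis by (auto simp: B'_def C'_def)
              have "ennreal (\<mu> B) + ennreal (\<mu> C) = ennreal (\<mu> (B' \<union> C'))"
                using vmeasures_on_Un[OF \<mu> bc(1-3)] vmeasures_on_empty[OF \<mu>]
                by (auto simp: B'_def C'_def ennreal_plus ennreal_neg)
              also have "\<dots> \<le> ?p (\<Union>i\<in>insert i I. A i)"
                using bc by (intro SUP_upper) auto
              finally show ?thesis .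
            qed
            then show ?thesis
              unfolding ennreal_SUP_add_left[OF ne, symmetric]
              unfolding ennreal_SUP_add_right[OF ne]
              by (intro SUP_least) blast
          qed
          with insert show ?case
            by (auto intro: order_trans[OF add_left_mono])
        qed (simp add: bot_ennreal)
        also have "?p (\<Union>i\<in>{..<n}. A i) \<le> ?p (\<Union>i. A i)"
          by (rule SUP_subset_mono) auto
        finally show ?thesis by simp
      qed
      then show "(\<Sum>i. ?p (A i)) \<le> ?p (\<Union>i. A i)"
        by (intro suminf_le_const) auto
    next
      show "?p (\<Union>i. A i) \<le> (\<Sum>i. ?p (A i))"
      proof (rule SUP_least)
        fix B assume "B \<in> {B \<in> sets borel. B \<subseteq> (\<Union>i. A i)}"
        then have B: "B \<in> sets borel" "(\<Union>i. B \<inter> A i) = B" by auto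
        have "(\<lambda>i. \<mu> (B \<inter> A i)) sums \<mu> (\<Union>i. B \<inter> A i)"
          using A B by (intro vmeasures_on_sums[OF \<mu>]) (auto simp: disjoint_family_on_def)
        then have lim: "(\<lambda>n. ennreal (\<Sum>i<n. \<mu> (B \<inter> A i))) \<longlonglongrightarrow> ennreal (\<mu> B)"
          using B(2) by (auto simp: sums_def)
        have "ennreal (\<Sum>i<n. \<mu> (B \<inter> A i)) \<le> (\<Sum>i. ?p (A i))" for n
        proof -
          have "ennreal (\<Sum>i<n. \<mu> (B \<inter> A i)) \<le> ennreal (\<Sum>i<n. max 0 (\<mu> (B \<inter> A i)))"
            by (intro ennreal_leI sum_mono) auto
          also have "\<dots> = (\<Sum>i<n. ennreal (max 0 (\<mu> (B \<inter> A i))))"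
            by (subst sum_ennreal) auto
          also have "\<dots> = (\<Sum>i<n. ennreal (\<mu> (B \<inter> A i)))"
            by (simp add: ennreal_max_0)
          also have "\<dots> \<le> (\<Sum>i<n. ?p (A i))"
            using A B by (intro sum_mono SUP_upper) auto
          also have "\<dots> \<le> (\<Sum>i. ?p (A i))"
            by (rule sum_le_suminf) auto
          finally show ?thesis .
        qed
        then show "ennreal (\<mu> B) \<le> (\<Sum>i. ?p (A i))"
          using LIMSEQ_le_const2[OF lim] by blast
      qed
    qed
  qed
qed (use assms in auto)

lemma sets_pos_part [simp, measurable_cong]:
  "sets (pos_part \<mu>) = sets (borel :: 'a::topological_space measure)"
  using sets.sigma_sets_eq[of "borel :: 'a measure"] by (simp add: pos_part_def)

lemma space_pos_part [simp]: "space (pos_part \<mu>) = UNIV"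
  by (simp add: pos_part_def)

lemma sets_neg_part [simp, measurable_cong]: "sets (neg_part \<mu>) = sets borel"
  by (simp add: neg_part_def)

lemma space_neg_part [simp]: "space (neg_part \<mu>) = UNIV"
  by (simp add: neg_part_def)

lemma finite_measure_pos_part:
  assumes "\<mu> \<in> vmeasures_on S"
  shows "finite_measure (pos_part \<mu>)"
proof
  obtain C where C: "\<And>A. \<bar>\<mu> A\<bar> \<le> C"
    using vmeasures_on_bounded[OF assms] by blast
  have "emeasure (pos_part \<mu>) UNIV \<le> ennreal C"
    unfolding emeasure_pos_part[OF assms borel_open[OF open_UNIV]]
    using C by (intro SUP_least ennreal_leI) (meson abs_le_D1)
  then show "emeasure (pos_part \<mu>) (space (pos_part \<mu>)) \<noteq> \<infinity>"
    by (auto simp: top_unique)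
qed

lemma finite_measure_neg_part:
  assumes "\<mu> \<in> vmeasures_on S"
  shows "finite_measure (neg_part \<mu>)"
  unfolding neg_part_def using vmeasures_on_uminus[OF assms] by (rule finite_measure_pos_part)

text \<open>For B inside A, additivity gives \<open>\<mu> B = \<mu> A - \<mu> (A - B)\<close>, and
  \<open>- \<mu> (A - B)\<close> is at most the negative part of A. The supremum over B is one
  inequality; the other one is the same argument for the opposite measure.\<close>

lemma jordan_decomposition:
  assumes \<mu>: "\<mu> \<in> vmeasures_on S" and A: "A \<in> sets borel"
  shows "\<mu> A = measure (pos_part \<mu>) A - measure (neg_part \<mu>) A"
proof -
  interpret p: finite_measure "pos_part \<mu>" by (rule finite_measure_pos_part[OF \<mu>])
  interpret n: finite_measure "neg_part \<mu>" by (rule finite_measure_neg_part[OF \<mu>])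
  have p: "\<mu> B \<le> measure (pos_part \<mu>) A" if "B \<in> sets borel" "B \<subseteq> A" for B
  proof -
    have "ennreal (\<mu> B) \<le> emeasure (pos_part \<mu>) A"
      unfolding emeasure_pos_part[OF \<mu> A] using that by (intro SUP_upper) auto
    then show ?thesis by (simp add: p.emeasure_eq_measure)
  qed
  have n: "- \<mu> B \<le> measure (neg_part \<mu>) A" if "B \<in> sets borel" "B \<subseteq> A" for B
  proof -
    have "ennreal (- \<mu> B) \<le> emeasure (neg_part \<mu>) A"
      unfolding neg_part_def emeasure_pos_part[OF vmeasures_on_uminus[OF \<mu>] A]
      using that by (intro SUP_upper) auto
    then show ?thesis by (simp add: n.emeasure_eq_measure)
  qed
  have "measure (pos_part \<mu>) A \<le> \<mu> A + measure (neg_part \<mu>) A"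
  proof -
    have "emeasure (pos_part \<mu>) A \<le> ennreal (\<mu> A + measure (neg_part \<mu>) A)"
      unfolding emeasure_pos_part[OF \<mu> A]
    proof (intro SUP_least ennreal_leI)
      fix B assume B: "B \<in> {B \<in> sets borel. B \<subseteq> A}"
      then show "\<mu> B \<le> \<mu> A + measure (neg_part \<mu>) A"
        using vmeasures_on_Diff[OF \<mu> A, of B] n[of "A - B"] A by auto
    qed
    moreover have "0 \<le> \<mu> A + measure (neg_part \<mu>) A"
      using n[of A] A by simp
    ultimately show ?thesis by (simp add: p.emeasure_eq_measure)
  qed
  moreover have "measure (neg_part \<mu>) A \<le> measure (pos_part \<mu>) A - \<mu> A"
  proof -
    have "emeasure (neg_part \<mu>) A \<le> ennreal (measure (pos_part \<mu>) A - \<mu> A)"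
      unfolding neg_part_def emeasure_pos_part[OF vmeasures_on_uminus[OF \<mu>] A]
    proof (intro SUP_least ennreal_leI)
      fix B assume B: "B \<in> {B \<in> sets borel. B \<subseteq> A}"
      then show "- \<mu> B \<le> measure (pos_part \<mu>) A - \<mu> A"
        using vmeasures_on_Diff[OF \<mu> A, of B] p[of "A - B"] A by auto
    qed
    moreover have "0 \<le> measure (pos_part \<mu>) A - \<mu> A"
      using p[of A] A by simp
    ultimately show ?thesis by (simp add: n.emeasure_eq_measure)
  qed
  ultimately show ?thesis by simp
qed

lemma emeasure_pos_part_outside:
  assumes \<mu>: "\<mu> \<in> vmeasures_on S" and A: "A \<in> sets borel" "A \<inter> S = {}"
  shows "emeasure (pos_part \<mu>) A = 0"
proof -
  have "\<mu> B = 0" if "B \<in> sets borel" "B \<subseteq> A" for B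
  proof -
    have "B \<inter> S = {}" using that A by auto
    then show ?thesis
      using vmeasures_on_Int[OF \<mu> that(1)] vmeasures_on_empty[OF \<mu>] by simp
  qed
  then have "emeasure (pos_part \<mu>) A \<le> 0"
    unfolding emeasure_pos_part[OF \<mu> A(1)] by (intro SUP_least) auto
  then show ?thesis by simp
qed

lemma emeasure_neg_part_outside:
  assumes "\<mu> \<in> vmeasures_on S" "A \<in> sets borel" "A \<inter> S = {}"
  shows "emeasure (neg_part \<mu>) A = 0"
  unfolding neg_part_def using assms by (intro emeasure_pos_part_outside[OF vmeasures_on_uminus])

text \<open>Lets an identity between differences of measures be stated as the equality of two sums
  of nonnegative measures, from which integrals can be read off. It also superposes the local
  rearrangements of a transport plan.\<close>

definition sum_measure :: "'i set \<Rightarrow> ('i \<Rightarrow> 'a::topological_space measure) \<Rightarrow> 'a measure" where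
  "sum_measure I M = measure_of UNIV (sets borel) (\<lambda>A. \<Sum>i\<in>I. emeasure (M i) A)"

lemma sets_sum_measure [simp, measurable_cong]:
  "sets (sum_measure I M) = sets (borel :: 'a::topological_space measure)"
  using sets.sigma_sets_eq[of "borel :: 'a measure"] by (simp add: sum_measure_def)

lemma space_sum_measure [simp]: "space (sum_measure I M) = UNIV"
  by (simp add: sum_measure_def)

lemma emeasure_sum_measure:
  fixes M :: "'i \<Rightarrow> 'a::topological_space measure"
  assumes M: "\<And>i. i \<in> I \<Longrightarrow> sets (M i) = sets borel" and "A \<in> sets borel"
  shows "emeasure (sum_measure I M) A = (\<Sum>i\<in>I. emeasure (M i) A)"
  unfolding sum_measure_def
proof (rule emeasure_measure_of_sigma)
  show "sigma_algebra UNIV (sets borel :: 'a set set)"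
    using sets.sigma_algebra_axioms[of "borel :: 'a measure"] by simp
  show "positive (sets borel) (\<lambda>A. \<Sum>i\<in>I. emeasure (M i) A)"
    by (auto simp: positive_def)
  show "countably_additive (sets borel) (\<lambda>A. \<Sum>i\<in>I. emeasure (M i) A)"
    by (rule countably_additiveI) (auto simp: M suminf_emeasure suminf_sum)
qed (use assms in auto)

lemma nn_integral_sum_measure:
  assumes M: "\<And>i. i \<in> I \<Longrightarrow> sets (M i) = sets borel" and g: "g \<in> borel_measurable borel"
  shows "(\<integral>\<^sup>+x. g x \<partial>sum_measure I M) = (\<Sum>i\<in>I. \<integral>\<^sup>+x. g x \<partial>M i)"
  using g
proof (induction g rule: borel_measurable_induct)
  case (cong f g)
  then show ?case by simp
next
  case (set A)
  then show ?case by (simp add: emeasure_sum_measure M)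
next
  case (mult u c)
  show ?case
    using mult by (simp add: nn_integral_cmult sum_distrib_left measurable_cong_sets[OF M refl])
next
  case (add u v)
  then show ?case
    by (simp add: nn_integral_add sum.distrib measurable_cong_sets[OF M refl])
next
  case (seq U)
  have "(\<integral>\<^sup>+x. (SUP i. U i x) \<partial>sum_measure I M) = (SUP k. \<integral>\<^sup>+x. U k x \<partial>sum_measure I M)"
    using seq by (intro nn_integral_monotone_convergence_SUP) auto
  also have "\<dots> = (SUP k. \<Sum>i\<in>I. \<integral>\<^sup>+x. U k x \<partial>M i)"
    using seq by simp
  also have "\<dots> = (\<Sum>i\<in>I. SUP k. \<integral>\<^sup>+x. U k x \<partial>M i)"
    using seq by (intro ennreal_SUP_sum)
       (auto simp: mono_def le_fun_def intro!: nn_integral_mono)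
  also have "\<dots> = (\<Sum>i\<in>I. \<integral>\<^sup>+x. (SUP k. U k x) \<partial>M i)"
    using seq by (intro sum.cong refl nn_integral_monotone_convergence_SUP[symmetric])
      (auto simp: measurable_cong_sets[OF M refl])
  finally show ?case by (simp add: image_comp)
qed

lemma integral_sum_measure:
  fixes g :: "'a::topological_space \<Rightarrow> real"
  assumes "finite I" and M: "\<And>i. i \<in> I \<Longrightarrow> sets (M i) = sets borel"
    and g: "g \<in> borel_measurable borel"
    and int: "\<And>i. i \<in> I \<Longrightarrow> integrable (M i) g"
  shows "(LINT x|sum_measure I M. g x) = (\<Sum>i\<in>I. LINT x|M i. g x)"
proof -
  have fin: "(\<integral>\<^sup>+x. ennreal (norm (g x)) \<partial>M i) < \<infinity>" if "i \<in> I" for i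
    using int[OF that] by (simp add: integrable_iff_bounded)
  have *: "(\<integral>\<^sup>+x. ennreal (norm (g x)) \<partial>sum_measure I M) < \<infinity>"
    using g fin \<open>finite I\<close> by (subst nn_integral_sum_measure) (auto simp: M ennreal_sum_less_top)
  then have i: "integrable (sum_measure I M) g"
    using g by (auto simp: integrable_iff_bounded)
  have f1: "(\<integral>\<^sup>+x. ennreal (g x) \<partial>M i) < \<infinity>" "(\<integral>\<^sup>+x. ennreal (- g x) \<partial>M i) < \<infinity>" if "i \<in> I" for i
    by (rule le_less_trans[OF nn_integral_mono fin[OF that]], rule ennreal_leI, simp)+
  have "(LINT x|sum_measure I M. g x) =
      enn2real (\<Sum>i\<in>I. \<integral>\<^sup>+x. ennreal (g x) \<partial>M i) - enn2real (\<Sum>i\<in>I. \<integral>\<^sup>+x. ennreal (- g x) \<partial>M i)"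
    using g by (simp add: real_lebesgue_integral_def[OF i] nn_integral_sum_measure M)
  also have "\<dots> = (\<Sum>i\<in>I. enn2real (\<integral>\<^sup>+x. ennreal (g x) \<partial>M i)) -
      (\<Sum>i\<in>I. enn2real (\<integral>\<^sup>+x. ennreal (- g x) \<partial>M i))"
    using f1 by (simp add: enn2real_sum)
  also have "\<dots> = (\<Sum>i\<in>I. LINT x|M i. g x)"
    using int by (simp add: real_lebesgue_integral_def sum_subtractf)
  finally show "(LINT x|sum_measure I M. g x) = (\<Sum>i\<in>I. LINT x|M i. g x)" .
qed

text \<open>Both sides integrate against one and the same sum measure. The four-term form expresses
  M1 - M3 = M4 - M2 without forming a difference; it serves both for Jordan parts and for mass moved
  within a plan.\<close>

lemma integral_exchange:
  fixes g :: "'a::topological_space \<Rightarrow> real"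
  assumes fin: "finite_measure M1" "finite_measure M2" "finite_measure M3" "finite_measure M4"
    and sets: "sets M1 = sets borel" "sets M2 = sets borel" "sets M3 = sets borel" "sets M4 = sets borel"
    and eq: "\<And>A. A \<in> sets borel \<Longrightarrow> emeasure M1 A + emeasure M2 A = emeasure M3 A + emeasure M4 A"
    and g: "g \<in> borel_measurable borel" "\<And>x. \<bar>g x\<bar> \<le> C"
  shows "(LINT x|M1. g x) + (LINT x|M2. g x) = (LINT x|M3. g x) + (LINT x|M4. g x)"
proof -
  have i: "integrable M g" if "finite_measure M" "sets M = sets borel" for M
    using that g by (intro finite_measure.integrable_const_bound[of _ _ C])
      (auto simp: measurable_cong_sets[OF that(2) refl])
  define P where "P = (\<lambda>b. if b then M1 else M2)"
  define Q where "Q = (\<lambda>b. if b then M3 else M4)"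
  have [simp]: "sets (P b) = sets borel" "sets (Q b) = sets borel" for b
    using sets by (auto simp: P_def Q_def)
  have "sum_measure UNIV P = sum_measure UNIV Q"
  proof (rule measure_eqI)
    fix A assume "A \<in> sets (sum_measure UNIV P)"
    then show "emeasure (sum_measure UNIV P) A = emeasure (sum_measure UNIV Q) A"
      using eq[of A] by (simp add: emeasure_sum_measure UNIV_bool) (simp add: P_def Q_def add.commute)
  qed simp
  moreover have "integrable (P b) g" "integrable (Q b) g" for b
    using i fin sets by (auto simp: P_def Q_def)
  ultimately have "(\<Sum>b\<in>UNIV. LINT x|P b. g x) = (\<Sum>b\<in>UNIV. LINT x|Q b. g x)"
    using integral_sum_measure[of UNIV P g] integral_sum_measure[of UNIV Q g] g(1) by simp
  then show ?thesis by (simp add: UNIV_bool P_def Q_def)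
qed

section \<open>Integrals against signed and vector measures\<close>

lemma set_integrable_bounded:
  fixes g :: "'a::topological_space \<Rightarrow> real"
  assumes "finite_measure M" and M: "sets M = sets borel"
    and g: "set_borel_measurable borel K g" "bounded (g ` K)"
  shows "set_integrable M K g"
proof -
  interpret finite_measure M by fact
  obtain C where C: "\<And>x. x \<in> K \<Longrightarrow> \<bar>g x\<bar> \<le> C"
    using g(2) by (auto simp: bounded_iff)
  show ?thesis
    unfolding set_integrable_def
  proof (rule integrable_const_bound[of _ "max 0 C"])
    show "AE x in M. norm (indicat_real K x *\<^sub>R g x) \<le> max 0 C"
      using C by (auto simp: indicator_def intro!: AE_I2 max.coboundedI2)
    show "(\<lambda>x. indicat_real K x *\<^sub>R g x) \<in> borel_measurable M"
      using g(1) by (simp add: set_borel_measurable_def measurable_cong_sets[OF M refl])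
  qed
qed

lemma continuous_on_compact_measurable_bounded:
  fixes g :: "'a::t2_space \<Rightarrow> real"
  assumes "compact K" "continuous_on K g"
  shows "set_borel_measurable borel K g" "bounded (g ` K)"
  unfolding set_borel_measurable_def using assms
  by (auto intro: borel_measurable_continuous_on_indicator borel_compact
        compact_imp_bounded compact_continuous_image simp del: real_scaleR_def)

lemma set_integrable_continuous_compact:
  fixes g :: "'a::t2_space \<Rightarrow> real"
  assumes "finite_measure M" "sets M = sets borel" "compact K" "continuous_on K g"
  shows "set_integrable M K g"
  using assms by (intro set_integrable_bounded continuous_on_compact_measurable_bounded)

lemma set_integral_diff_bound:
  fixes g h :: "'a::topological_space \<Rightarrow> real"
  assumes "finite_measure M" "sets M = sets borel" "K \<in> sets borel"
    and "set_integrable M K g" "set_integrable M K h"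
    and le: "\<And>x. x \<in> K \<Longrightarrow> \<bar>g x - h x\<bar> \<le> e"
  shows "\<bar>(LINT x:K|M. g x) - (LINT x:K|M. h x)\<bar> \<le> e * measure M K"
proof -
  interpret finite_measure M by fact
  have K: "K \<in> sets M" using assms by simp
  have "\<bar>(LINT x:K|M. g x) - (LINT x:K|M. h x)\<bar> = \<bar>LINT x:K|M. g x - h x\<bar>"
    using assms by (simp add: set_integral_diff)
  also have "\<dots> \<le> (LINT x:K|M. \<bar>g x - h x\<bar>)"
    using set_integral_norm_bound[OF set_integral_diff(1)[OF assms(4,5)]] by simp
  also have "\<dots> \<le> (LINT x:K|M. e)"
    using assms K le
    by (intro set_integral_mono set_integrable_abs set_integral_diff)
       (auto simp: set_integrable_def emeasure_eq_measure)
  also have "\<dots> = e * measure M K"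
    using K by (simp add: set_lebesgue_integral_def emeasure_eq_measure)
  finally show ?thesis .
qed

text \<open>Holds because \<open>pos_part \<mu>\<close> plus \<open>N\<close> and
  \<open>neg_part \<mu>\<close> plus \<open>M\<close> are the same measure. It is for
  representations by measures \<open>M\<close> and \<open>N\<close> that share mass and hence differ
  from the Jordan parts.\<close>

lemma signed_integral_eq:
  assumes \<mu>: "\<mu> \<in> vmeasures_on S" and fin: "finite_measure M" "finite_measure N"
    and sets: "sets M = sets borel" "sets N = sets borel"
    and eq: "\<And>A. A \<in> sets borel \<Longrightarrow> \<mu> A = measure M A - measure N A"
    and g: "set_borel_measurable borel K g" "bounded (g ` K)"
  shows "signed_integral K \<mu> g = (LINT x:K|M. g x) - (LINT x:K|N. g x)"
proof -
  interpret p: finite_measure "pos_part \<mu>" by (rule finite_measure_pos_part[OF \<mu>])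
  interpret n: finite_measure "neg_part \<mu>" by (rule finite_measure_neg_part[OF \<mu>])
  interpret M: finite_measure M by fact
  interpret N: finite_measure N by fact
  obtain C where C: "\<And>x. x \<in> K \<Longrightarrow> \<bar>g x\<bar> \<le> C"
    using g(2) by (auto simp: bounded_iff)
  have "(LINT x|pos_part \<mu>. indicat_real K x *\<^sub>R g x) + (LINT x|N. indicat_real K x *\<^sub>R g x) =
      (LINT x|neg_part \<mu>. indicat_real K x *\<^sub>R g x) + (LINT x|M. indicat_real K x *\<^sub>R g x)"
  proof (rule integral_exchange[where C = "max 0 C"])
    fix A :: "'a set" assume A: "A \<in> sets borel"
    show "emeasure (pos_part \<mu>) A + emeasure N A = emeasure (neg_part \<mu>) A + emeasure M A"
      using eq[OF A] jordan_decomposition[OF \<mu> A]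
      by (simp add: p.emeasure_eq_measure n.emeasure_eq_measure M.emeasure_eq_measure
           N.emeasure_eq_measure flip: ennreal_plus)
  next
    show "\<bar>indicat_real K x *\<^sub>R g x\<bar> \<le> max 0 C" for x
      using C[of x] by (auto simp: indicator_def)
  qed (use sets fin g p.finite_measure_axioms n.finite_measure_axioms in \<open>auto simp: set_borel_measurable_def\<close>)
  then show ?thesis
    by (simp add: signed_integral_def set_lebesgue_integral_def)
qed

lemma signed_integral_diff_bound:
  assumes \<mu>: "\<mu> \<in> vmeasures_on S" and K: "K \<in> sets borel"
    and g: "set_borel_measurable borel K g" "bounded (g ` K)"
    and h: "set_borel_measurable borel K h" "bounded (h ` K)"
    and le: "\<And>x. x \<in> K \<Longrightarrow> \<bar>g x - h x\<bar> \<le> e"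
  shows "\<bar>signed_integral K \<mu> g - signed_integral K \<mu> h\<bar>
    \<le> e * (measure (pos_part \<mu>) K + measure (neg_part \<mu>) K)"
proof -
  note p = finite_measure_pos_part[OF \<mu>] sets_pos_part[of \<mu>]
  note n = finite_measure_neg_part[OF \<mu>] sets_neg_part[of \<mu>]
  have "\<bar>(LINT x:K|pos_part \<mu>. g x) - (LINT x:K|pos_part \<mu>. h x)\<bar> \<le> e * measure (pos_part \<mu>) K"
    using set_integral_diff_bound[OF p K set_integrable_bounded[OF p g] set_integrable_bounded[OF p h] le] .
  moreover
  have "\<bar>(LINT x:K|neg_part \<mu>. g x) - (LINT x:K|neg_part \<mu>. h x)\<bar> \<le> e * measure (neg_part \<mu>) K"
    using set_integral_diff_bound[OF n K set_integrable_bounded[OF n g] set_integrable_bounded[OF n h] le] .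
  ultimately show ?thesis
    unfolding signed_integral_def distrib_left by linarith
qed

lemma signed_integral_step:
  assumes \<mu>: "\<mu> \<in> vmeasures_on S" and "finite I"
    and A: "\<And>i. i \<in> I \<Longrightarrow> A i \<in> sets borel" "\<And>i. i \<in> I \<Longrightarrow> A i \<subseteq> K"
  shows "signed_integral K \<mu> (\<lambda>x. \<Sum>i\<in>I. indicator (A i) x * c i) = (\<Sum>i\<in>I. c i * \<mu> (A i))"
proof -
  have *: "(LINT x:K|M. (\<Sum>i\<in>I. indicator (A i) x * c i)) = (\<Sum>i\<in>I. c i * measure M (A i))"
    if "finite_measure M" "sets M = sets borel" for M
  proof -
    interpret finite_measure M by fact
    have "(LINT x:K|M. (\<Sum>i\<in>I. indicator (A i) x * c i)) = (LINT x|M. (\<Sum>i\<in>I. indicat_real (A i) x * c i))"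
      unfolding set_lebesgue_integral_def
    proof (intro Bochner_Integration.integral_cong refl)
      fix x
      have "(\<Sum>i\<in>I. indicat_real (A i) x * c i) = 0" if "x \<notin> K"
        using A(2) that by (intro sum.neutral) (auto simp: indicator_def)
      then show "indicat_real K x *\<^sub>R (\<Sum>i\<in>I. indicat_real (A i) x * c i) =
          (\<Sum>i\<in>I. indicat_real (A i) x * c i)"
        by (cases "x \<in> K") simp_all
    qed
    also have "\<dots> = (\<Sum>i\<in>I. LINT x|M. indicat_real (A i) x * c i)"
      using A that by (intro Bochner_Integration.integral_sum)
        (auto simp: emeasure_eq_measure)
    also have "\<dots> = (\<Sum>i\<in>I. c i * measure M (A i))"
      using A that by (intro sum.cong refl) simp
    finally show ?thesis .
  qed
  show ?thesis
    unfolding signed_integral_def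
    using A
    by (simp add: * finite_measure_pos_part[OF \<mu>] finite_measure_neg_part[OF \<mu>]
         jordan_decomposition[OF \<mu>] right_diff_distrib sum_subtractf)
qed

text \<open>An indexed family is used because the disjoint pieces cut out of a cover may be empty,
  which \<open>partition_on\<close> forbids. Empty pieces contribute 0 and are dropped; disjointness
  makes the indexing of the others injective.\<close>

lemma sum_norm_le_total_variation:
  assumes v: "v {} = 0" and "finite I" "\<And>i. i \<in> I \<Longrightarrow> A i \<in> sets borel" "disjoint_family_on A I"
    and S: "(\<Union>i\<in>I. A i) = S"
  shows "ereal (\<Sum>i\<in>I. norm (v (A i))) \<le> total_variation S v"
proof -
  define J where "J = {i\<in>I. A i \<noteq> {}}"
  have inj: "inj_on A J"
    using assms(4) unfolding inj_on_def J_def disjoint_family_on_def by blast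
  have "(\<Sum>i\<in>I. norm (v (A i))) = (\<Sum>i\<in>J. norm (v (A i)))"
    using v \<open>finite I\<close> by (intro sum.mono_neutral_right) (auto simp: J_def)
  also have "\<dots> = (\<Sum>B\<in>A ` J. norm (v B))"
    using inj by (simp add: sum.reindex)
  also have "ereal \<dots> \<le> total_variation S v"
    unfolding total_variation_def
  proof (rule SUP_upper, intro CollectI conjI)
    show "partition_on S (A ` J)"
      using assms(4) S unfolding partition_on_def J_def disjoint_def disjoint_family_on_def by fastforce
  qed (use assms J_def in auto)
  finally show ?thesis .
qed

text \<open>\<open>G\<close> is replaced by a field that is constant on the small pieces of a
  partition, where Cauchy-Schwarz bounds each term by the norm of \<open>v\<close> on the piece. The
  integral is defined by coordinates; these are recombined into an inner product before the
  estimate, as otherwise a dimensional constant would appear.\<close>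

lemma vector_integral_le_total_variation:
  fixes v :: "'a::metric_space set \<Rightarrow> 'b::euclidean_space"
  assumes v: "v \<in> vmeasures_on K" and K: "compact K" and G: "continuous_on K G"
    and G1: "\<And>x. x \<in> K \<Longrightarrow> norm (G x) \<le> 1"
  shows "ereal (vector_integral K v G) \<le> total_variation K v"
proof (rule ereal_le_epsilon2)
  fix e :: real assume "e > 0"
  define \<mu> where "\<mu> b = (\<lambda>A. v A \<bullet> b)" for b
  have \<mu>: "\<mu> b \<in> vmeasures_on K" for b
    unfolding \<mu>_def using v by (rule vmeasures_on_inner)
  \<comment> \<open>\<open>V\<close> is the total mass of all coordinate measures, so a uniform
    error \<open>e'\<close> in every coordinate costs at most \<open>e\<close>. The 1 in the
    denominator of \<open>e'\<close> covers the case \<open>V = 0\<close>.\<close>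
  define V where "V = (\<Sum>b\<in>Basis. measure (pos_part (\<mu> b)) K + measure (neg_part (\<mu> b)) K)"
  have V: "V \<ge> 0" unfolding V_def by (intro sum_nonneg) auto
  define e' where "e' = e / (V + 1)"
  have e': "e' > 0" "e' * V \<le> e"
    using V \<open>e > 0\<close> by (auto simp: e'_def field_simps)
  obtain d where d: "d > 0" "\<And>x y. x \<in> K \<Longrightarrow> y \<in> K \<Longrightarrow> dist y x < d \<Longrightarrow> dist (G y) (G x) < e'"
    using compact_uniformly_continuous[OF G K] \<open>e' > 0\<close> unfolding uniformly_continuous_on_def by metis
  obtain N where N: "N \<subseteq> K" "finite N" "K \<subseteq> (\<Union>p\<in>N. ball p d)"
  proof (rule compactE_image[OF K, of K "\<lambda>p. ball p d"])
    show "K \<subseteq> (\<Union>p\<in>K. ball p d)" using \<open>d > 0\<close> by force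
  qed (auto intro: that)
  \<comment> \<open>An arbitrary enumeration of the net makes the covering balls disjoint: each
    point goes to the first ball that contains it.\<close>
  obtain idx :: "'a \<Rightarrow> nat" where idx: "inj_on idx N"
    using \<open>finite N\<close> finite_imp_inj_to_nat_seg by blast
  define A where "A p = K \<inter> ball p d - (\<Union>q\<in>{q\<in>N. idx q < idx p}. ball q d)" for p
  have A_borel: "A p \<in> sets borel" for p
    unfolding A_def using \<open>finite N\<close> K
    by (intro sets.Diff sets.Int sets.finite_UN) (auto intro: borel_compact)
  have A_disj: "disjoint_family_on A N"
  proof -
    have "A p \<inter> A q = {}" if "p \<in> N" "q \<in> N" "idx p < idx q" for p q
      using that by (auto simp: A_def)
    then show ?thesis
      using idx unfolding disjoint_family_on_def inj_on_def
      by (metis inf_commute nat_neq_iff)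
  qed
  have A_UN: "(\<Union>p\<in>N. A p) = K"
  proof
    show "K \<subseteq> (\<Union>p\<in>N. A p)"
    proof
      fix x assume "x \<in> K"
      then obtain p0 where "p0 \<in> N \<and> x \<in> ball p0 d" using N(3) by blast
      then obtain p where p: "p \<in> N" "x \<in> ball p d"
        and least: "\<And>q. q \<in> N \<Longrightarrow> x \<in> ball q d \<Longrightarrow> idx p \<le> idx q"
        using ex_has_least_nat[of "\<lambda>p. p \<in> N \<and> x \<in> ball p d" p0 idx] by blast
      then have "x \<in> A p"
        unfolding A_def using \<open>x \<in> K\<close> leD by blast
      then show "x \<in> (\<Union>p\<in>N. A p)" using p by blast
    qed
  qed (auto simp: A_def)
  define s where "s b x = (\<Sum>p\<in>N. indicat_real (A p) x * (G p \<bullet> b))" for b x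
  have s_eq: "s b x = G p \<bullet> b" if "x \<in> A p" "p \<in> N" for b x p
  proof -
    have "s b x = (\<Sum>q\<in>N. if q = p then G p \<bullet> b else 0)"
      unfolding s_def using A_disj that
      by (intro sum.cong refl) (auto simp: indicator_def disjoint_family_on_def)
    then show ?thesis using that \<open>finite N\<close> by simp
  qed
  have close: "\<bar>G x \<bullet> b - s b x\<bar> \<le> e'" if "x \<in> K" "b \<in> Basis" for x b
  proof -
    obtain p where p: "p \<in> N" "x \<in> A p" using A_UN \<open>x \<in> K\<close> by auto
    then have "dist (G x) (G p) < e'"
      using N \<open>x \<in> K\<close> by (intro d(2)) (auto simp: A_def dist_commute)
    moreover have "\<bar>(G x - G p) \<bullet> b\<bar> \<le> norm (G x - G p)"
      using Basis_le_norm[OF that(2)] by simp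
    ultimately show ?thesis
      using s_eq[OF p(2,1)] by (simp add: dist_norm inner_diff_left)
  qed
  have step: "signed_integral K (\<mu> b) (s b) = (\<Sum>p\<in>N. (G p \<bullet> b) * \<mu> b (A p))" for b
    unfolding s_def[abs_def] using \<mu> \<open>finite N\<close> A_borel
    by (intro signed_integral_step) (auto simp: A_def)
  have sm: "set_borel_measurable borel K (s b)" for b
    unfolding s_def set_borel_measurable_def using A_borel borel_compact[OF K]
    by (intro borel_measurable_scaleR borel_measurable_indicator borel_measurable_sum
        borel_measurable_times) auto
  have sb: "bounded (s b ` K)" for b
  proof -
    have "s b ` K \<subseteq> (\<lambda>p. G p \<bullet> b) ` N"
      using s_eq A_UN by force
    then show ?thesis using \<open>finite N\<close> by (meson finite_imageI finite_imp_bounded bounded_subset)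
  qed
  have "vector_integral K v G = (\<Sum>b\<in>Basis. signed_integral K (\<mu> b) (\<lambda>x. G x \<bullet> b))"
    by (simp add: vector_integral_def \<mu>_def)
  also have "\<dots> \<le> (\<Sum>b\<in>Basis. signed_integral K (\<mu> b) (s b) +
      e' * (measure (pos_part (\<mu> b)) K + measure (neg_part (\<mu> b)) K))"
  proof (rule sum_mono)
    fix b :: 'b assume b: "b \<in> Basis"
    have c: "continuous_on K (\<lambda>x. G x \<bullet> b)" by (intro continuous_intros G)
    have "\<bar>signed_integral K (\<mu> b) (\<lambda>x. G x \<bullet> b) - signed_integral K (\<mu> b) (s b)\<bar>
      \<le> e' * (measure (pos_part (\<mu> b)) K + measure (neg_part (\<mu> b)) K)"
      using \<mu> borel_compact[OF K] continuous_on_compact_measurable_bounded[OF K c] sm sb close b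
      by (intro signed_integral_diff_bound)
    then show "signed_integral K (\<mu> b) (\<lambda>x. G x \<bullet> b) \<le> signed_integral K (\<mu> b) (s b) +
      e' * (measure (pos_part (\<mu> b)) K + measure (neg_part (\<mu> b)) K)" by linarith
  qed
  also have "\<dots> = (\<Sum>p\<in>N. G p \<bullet> v (A p)) + e' * V"
  proof -
    have "(\<Sum>b\<in>Basis. \<Sum>p\<in>N. (G p \<bullet> b) * \<mu> b (A p)) = (\<Sum>p\<in>N. G p \<bullet> v (A p))"
      by (subst sum.swap) (simp only: \<mu>_def euclidean_inner[symmetric])
    then show ?thesis
      by (simp add: sum.distrib step V_def sum_distrib_left distrib_left)
  qed
  also have "\<dots> \<le> (\<Sum>p\<in>N. norm (v (A p))) + e"
  proof (intro add_mono sum_mono e')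
    fix p assume "p \<in> N"
    then have "norm (G p) * norm (v (A p)) \<le> 1 * norm (v (A p))"
      using G1 N by (intro mult_right_mono) auto
    then show "G p \<bullet> v (A p) \<le> norm (v (A p))"
      using norm_cauchy_schwarz[of "G p" "v (A p)"] by linarith
  qed
  finally have "ereal (vector_integral K v G) \<le> ereal (\<Sum>p\<in>N. norm (v (A p))) + ereal e"
    by simp
  also have "\<dots> \<le> total_variation K v + ereal e"
    using \<open>finite N\<close> A_borel A_disj A_UN
    by (intro add_right_mono sum_norm_le_total_variation vmeasures_on_empty[OF v])
  finally show "ereal (vector_integral K v G) \<le> total_variation K v + ereal e" .
qed

section \<open>Smooth test functions and weak duality\<close>

text \<open>The indicator of a closed set is the pointwise limit of the continuous powers of 1 / (1
  + distance), which are bounded by 1, and the closed sets are an intersection-stable generator of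
  the Borel sets.\<close>

lemma borel_measure_eqI_continuous:
  fixes M N :: "'a::metric_space measure"
  assumes fin: "finite_measure M" "finite_measure N"
    and sets: "sets M = sets borel" "sets N = sets borel"
    and K: "K \<in> sets borel" "emeasure M (- K) = 0" "emeasure N (- K) = 0"
    and eq: "\<And>g :: 'a \<Rightarrow> real. continuous_on UNIV g \<Longrightarrow> (LINT x:K|M. g x) = (LINT x:K|N. g x)"
  shows "M = N"
proof (rule measure_eqI_generator_eq[where E = "{C. closed C}" and \<Omega> = UNIV and A = "\<lambda>_. UNIV"])
  fix C :: "'a set" assume "C \<in> {C. closed C}"
  then have C: "closed C" "C \<in> sets borel" by auto
  show "emeasure M C = emeasure N C"
  \<comment> \<open>The empty set is treated apart because \<open>infdist x {}\<close> is 0 by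
    convention, so the powers below would not tend to its indicator.\<close>
  proof (cases "C = {}")
    case False
    define g where "g n x = (1 / (1 + infdist x C)) ^ n" for n :: nat and x
    have g: "continuous_on UNIV (g n)" "g n \<in> borel_measurable borel" for n
    proof -
      show *: "continuous_on UNIV (g n)"
        unfolding g_def[abs_def]
        by (intro continuous_intros) (auto simp: add_nonneg_eq_0_iff infdist_nonneg)
      show "g n \<in> borel_measurable borel" using borel_measurable_continuous_onI[OF *] .
    qed
    have lim: "(\<lambda>n. LINT x:K|L. g n x) \<longlonglongrightarrow> measure L C"
      if L: "finite_measure L" "sets L = sets borel" "emeasure L (- K) = 0" for L
    proof -
      interpret finite_measure L by fact
      have [simp]: "space L = UNIV" using sets_eq_imp_space_eq[OF L(2)] by simp
      have "(\<lambda>n. LINT x|L. indicat_real K x *\<^sub>R g n x) \<longlonglongrightarrow> (LINT x|L. indicat_real (C \<inter> K) x)"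
      proof (rule integral_dominated_convergence[where w = "\<lambda>_. 1"])
        show "indicat_real (C \<inter> K) \<in> borel_measurable L"
          using C K L by (intro borel_measurable_indicator) auto
        show "AE x in L. (\<lambda>n. indicat_real K x *\<^sub>R g n x) \<longlonglongrightarrow> indicat_real (C \<inter> K) x"
        proof (rule AE_I2)
          fix x
          show "(\<lambda>n. indicat_real K x *\<^sub>R g n x) \<longlonglongrightarrow> indicat_real (C \<inter> K) x"
          proof (cases "x \<in> C")
            case True
            then show ?thesis by (simp add: g_def indicator_def)
          next
            case False
            then have "infdist x C > 0"
              using infdist_pos_not_in_closed[OF C(1) \<open>C \<noteq> {}\<close>] by simp
            then have "(\<lambda>n. g n x) \<longlonglongrightarrow> 0"
              unfolding g_def by (intro LIMSEQ_power_zero) simp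
            then have "(\<lambda>n. indicat_real K x *\<^sub>R g n x) \<longlonglongrightarrow> indicat_real K x *\<^sub>R 0"
              by (intro tendsto_intros)
            then show ?thesis using False by simp
          qed
        qed
        show "AE x in L. norm (indicat_real K x *\<^sub>R g n x) \<le> 1" for n
        proof (rule AE_I2)
          fix x
          have "0 \<le> g n x" "g n x \<le> 1"
            using infdist_nonneg[of x C] by (auto simp: g_def intro!: power_le_one)
          then show "norm (indicat_real K x *\<^sub>R g n x) \<le> 1"
            by (simp add: indicator_def)
        qed
        show "(\<lambda>x. indicat_real K x *\<^sub>R g n x) \<in> borel_measurable L" for n
          using g K L by (auto simp: measurable_cong_sets[OF L(2) refl])
      qed simp
      moreover have "(LINT x|L. indicat_real (C \<inter> K) x) = measure L (C \<inter> K)"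
        by simp
      moreover have "measure L (C \<inter> K) = measure L C"
      proof -
        have "measure L (C \<inter> K) = measure L (C - (C - K))"
          by (rule arg_cong[where f = "measure L"]) auto
        also have "\<dots> = measure L C"
        proof (rule measure_Diff_null_set)
          have "emeasure L (C - K) \<le> emeasure L (- K)"
            using K L by (intro emeasure_mono) auto
          then show "C - K \<in> null_sets L"
            using K L C by (auto simp: null_sets_def)
        qed (use C L in auto)
        finally show ?thesis .
      qed
      ultimately show ?thesis by (simp add: set_lebesgue_integral_def)
    qed
    have "measure M C = measure N C"
      using lim[OF fin(1) sets(1) K(2)] lim[OF fin(2) sets(2) K(3)] eq[OF g(1)] LIMSEQ_unique by simp
    then show ?thesis
      using fin by (simp add: finite_measure.emeasure_eq_measure)
  qed simp
next
  show "Int_stable {C :: 'a set. closed C}" by (auto simp: Int_stable_def)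
  show "sets M = sigma_sets UNIV {C. closed C}" "sets N = sigma_sets UNIV {C. closed C}"
    using sets by (simp_all add: borel_eq_closed)
  show "emeasure M UNIV \<noteq> \<infinity>" for i :: nat
    using finite_measure.emeasure_finite[OF fin(1)] by simp
qed auto

text \<open>Adding the Jordan parts crosswise turns the claim into the equality of two nonnegative
  measures, which continuous functions detect.\<close>

lemma vmeasures_on_real_eqI:
  fixes \<mu> \<nu> :: "'a::metric_space set \<Rightarrow> real"
  assumes \<mu>: "\<mu> \<in> vmeasures_on K" and \<nu>: "\<nu> \<in> vmeasures_on K" and K: "compact K"
    and eq: "\<And>g. continuous_on K g \<Longrightarrow> signed_integral K \<mu> g = signed_integral K \<nu> g"
  shows "\<mu> = \<nu>"
proof -
  define P where "P = (\<lambda>b. if b then pos_part \<mu> else neg_part \<nu>)"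
  define Q where "Q = (\<lambda>b. if b then neg_part \<mu> else pos_part \<nu>)"
  have Kb: "K \<in> sets borel" using borel_compact[OF K] .
  have fin: "finite_measure (P b)" "finite_measure (Q b)" for b
    using \<mu> \<nu> finite_measure_pos_part finite_measure_neg_part by (auto simp: P_def Q_def)
  have [simp]: "sets (P b) = sets borel" "sets (Q b) = sets borel"
     "space (P b) = UNIV" "space (Q b) = UNIV" for b
    by (auto simp: P_def Q_def)
  have null: "emeasure (P b) (- K) = 0" "emeasure (Q b) (- K) = 0" for b
    using emeasure_pos_part_outside[OF \<mu>, of "- K"] emeasure_neg_part_outside[OF \<mu>, of "- K"]
      emeasure_pos_part_outside[OF \<nu>, of "- K"] emeasure_neg_part_outside[OF \<nu>, of "- K"] Kb
    by (auto simp: P_def Q_def)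
  have em: "emeasure (sum_measure UNIV P) A = emeasure (P True) A + emeasure (P False) A"
    "emeasure (sum_measure UNIV Q) A = emeasure (Q True) A + emeasure (Q False) A"
    if "A \<in> sets borel" for A
    using that by (simp_all add: emeasure_sum_measure UNIV_bool add.commute)
  have "sum_measure UNIV P = sum_measure UNIV Q"
  proof (rule borel_measure_eqI_continuous[OF _ _ _ _ Kb])
    fix g :: "'a \<Rightarrow> real" assume g: "continuous_on UNIV g"
    then have gK: "continuous_on K g" by (rule continuous_on_subset) simp
    have gm: "set_borel_measurable borel K g"
      using continuous_on_compact_measurable_bounded(1)[OF K gK] .
    have i: "integrable (P b) (\<lambda>x. indicat_real K x *\<^sub>R g x)"
        "integrable (Q b) (\<lambda>x. indicat_real K x *\<^sub>R g x)" for b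
      using set_integrable_continuous_compact[OF fin(1) _ K gK]
        set_integrable_continuous_compact[OF fin(2) _ K gK]
      by (simp_all add: set_integrable_def)
    have "(LINT x:K|sum_measure UNIV P. g x) = (LINT x:K|P True. g x) + (LINT x:K|P False. g x)"
      "(LINT x:K|sum_measure UNIV Q. g x) = (LINT x:K|Q True. g x) + (LINT x:K|Q False. g x)"
      unfolding set_lebesgue_integral_def
      using gm i by (subst integral_sum_measure; simp add: set_borel_measurable_def UNIV_bool)+
    with eq[OF gK] show "(LINT x:K|sum_measure UNIV P. g x) = (LINT x:K|sum_measure UNIV Q. g x)"
      by (simp add: signed_integral_def P_def Q_def)
  qed (use fin Kb in \<open>auto simp: em null finite_measure.emeasure_finite intro!: finite_measureI\<close>)
  then have *: "emeasure (P True) A + emeasure (P False) A = emeasure (Q True) A + emeasure (Q False) A"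
    if "A \<in> sets borel" for A
    using em[OF that] by simp
  have "measure (P True) A + measure (P False) A = measure (Q True) A + measure (Q False) A"
    if "A \<in> sets borel" for A
    using *[OF that] fin by (simp add: finite_measure.emeasure_eq_measure flip: ennreal_plus)
  then have "\<mu> A = \<nu> A" if "A \<in> sets borel" for A
    using jordan_decomposition[OF \<mu> that] jordan_decomposition[OF \<nu> that] that
    by (force simp: P_def Q_def)
  moreover have "\<mu> A = \<nu> A" if "A \<notin> sets borel" for A
    using vmeasures_on_not_borel[OF \<mu> that] vmeasures_on_not_borel[OF \<nu> that] by simp
  ultimately show ?thesis by blast
qed

text \<open>Test fields \<open>g x *\<^sub>R b\<close> in the direction of one basis vector isolate
  a coordinate. This is the uniqueness half of the description of \<open>plan_flow\<close>.\<close>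

lemma vmeasures_on_eqI:
  fixes v w :: "'a::metric_space set \<Rightarrow> 'b::euclidean_space"
  assumes v: "v \<in> vmeasures_on K" and w: "w \<in> vmeasures_on K" and K: "compact K"
    and eq: "\<And>\<xi>. continuous_on K \<xi> \<Longrightarrow> vector_integral K v \<xi> = vector_integral K w \<xi>"
  shows "v = w"
proof -
  have "(\<lambda>A. v A \<bullet> b) = (\<lambda>A. w A \<bullet> b)" if b: "b \<in> Basis" for b
  proof (rule vmeasures_on_real_eqI[OF vmeasures_on_inner[OF v] vmeasures_on_inner[OF w] K])
    fix g :: "'a \<Rightarrow> real" assume g: "continuous_on K g"
    have *: "vector_integral K u (\<lambda>x. g x *\<^sub>R b) = signed_integral K (\<lambda>A. u A \<bullet> b) g"
      for u :: "'a set \<Rightarrow> 'b"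
    proof -
      have z: "signed_integral K (\<lambda>A. u A \<bullet> b') (\<lambda>x. (g x *\<^sub>R b) \<bullet> b') = 0"
        if "b' \<in> Basis - {b}" for b'
        using inner_not_same_Basis[OF b, of b'] that
        by (auto simp: signed_integral_def set_lebesgue_integral_def)
      have "vector_integral K u (\<lambda>x. g x *\<^sub>R b) =
          signed_integral K (\<lambda>A. u A \<bullet> b) (\<lambda>x. (g x *\<^sub>R b) \<bullet> b) + 0"
        unfolding vector_integral_def sum.remove[OF finite_Basis b]
        by (intro arg_cong2[where f = plus] refl sum.neutral ballI z)
      then show ?thesis using b by (simp add: inner_same_Basis)
    qed
    show "signed_integral K (\<lambda>A. v A \<bullet> b) g = signed_integral K (\<lambda>A. w A \<bullet> b) g"
      using eq[of "\<lambda>x. g x *\<^sub>R b"] g by (simp add: * continuous_intros)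
  qed
  from fun_cong[OF this] show ?thesis
    by - (rule ext, rule euclidean_eqI)
qed

text \<open>No mollifier is needed: the soft minimum of the smoothed cones \<open>\<psi> a + sqrt (|x - a|\<^sup>2 + \<delta>\<^sup>2)\<close>
  over a finite net of points \<open>a\<close> is smooth, and its gradient is a convex combination of
  gradients of norm at most 1.\<close>

lemma lipschitz_C1_approximation:
  fixes K :: "'a::euclidean_space set" and \<psi> :: "'a \<Rightarrow> real"
  assumes K: "compact K" "K \<noteq> {}" and \<psi>: "1-lipschitz_on K \<psi>" and "e > 0"
  obtains F G where "\<And>x. GDERIV F x :> G x" "continuous_on UNIV G" "\<And>x. norm (G x) \<le> 1"
    "\<And>x. x \<in> K \<Longrightarrow> \<bar>F x - \<psi> x\<bar> \<le> e"
proof -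
  \<comment> \<open>At a net point \<open>a\<close> within \<open>d\<close> of \<open>x\<close>, the
    upper bound loses \<open>d\<close> from the change of \<open>\<psi>\<close>, \<open>d\<close>
    from the distance and \<open>d\<close> from the smoothing of the cone.\<close>
  define d where "d = e / 3"
  have d: "d > 0" "3 * d = e" using \<open>e > 0\<close> by (auto simp: d_def)
  obtain N where N: "N \<subseteq> K" "finite N" "K \<subseteq> (\<Union>p\<in>N. ball p d)"
  proof (rule compactE_image[OF K(1), of K "\<lambda>p. ball p d"])
    show "K \<subseteq> (\<Union>p\<in>K. ball p d)" using \<open>d > 0\<close> by force
  qed (auto intro: that)
  have "N \<noteq> {}" using N K by auto
  then have card: "card N \<ge> 1" using N by (simp add: Suc_leI card_gt_0_iff)
  \<comment> \<open>The soft minimum of n numbers lies below their minimum by at most ln n / k. The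
    added 1 keeps \<open>k\<close> positive when the net is a single point.\<close>
  define k where "k = ln (card N) / d + 1"
  have "ln (card N) \<ge> 0" using card by simp
  then have k: "k > 0" "ln (card N) / k \<le> d"
    using d by (auto simp: k_def field_simps add_nonneg_pos)
  define r where "r a x = sqrt ((x - a) \<bullet> (x - a) + d\<^sup>2)" for a x :: 'a
  have pos: "(x - a) \<bullet> (x - a) + d\<^sup>2 > 0" for a x :: 'a
    using d by (simp add: add_nonneg_pos)
  have r_pos: "r a x > 0" for a x using pos by (simp add: r_def)
  have r_ge: "norm (x - a) \<le> r a x" for a x
    unfolding r_def norm_eq_sqrt_inner by (rule real_sqrt_le_mono) simp
  define E where "E a x = exp (- k * (\<psi> a + r a x))" for a x
  define Z where "Z x = (\<Sum>a\<in>N. E a x)" for x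
  have E_pos: "E a x > 0" for a x by (simp add: E_def)
  have Z_pos: "Z x > 0" for x
    unfolding Z_def using N \<open>N \<noteq> {}\<close> E_pos by (intro sum_pos)
  define F where "F x = - ln (Z x) / k" for x
  define G where "G x = (- (1 / (k * Z x))) *\<^sub>R (\<Sum>a\<in>N. (- k * E a x) *\<^sub>R ((1 / r a x) *\<^sub>R (x - a)))" for x
  have "GDERIV F x :> G x" for x
  proof -
    have q: "GDERIV (\<lambda>x. (x - a) \<bullet> (x - a) + d\<^sup>2) x :> 2 *\<^sub>R (x - a)" for a x :: 'a
      unfolding gderiv_def by (auto intro!: derivative_eq_intros simp: inner_simps inner_commute)
    have "DERIV sqrt s :> 1 / (2 * sqrt s)" if "s > 0" for s
      using DERIV_real_sqrt[OF that] by (simp add: field_simps)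
    from GDERIV_DERIV_compose[OF q this[OF pos]]
    have "GDERIV (r a) x :> (1 / r a x) *\<^sub>R (x - a)" for a
      by (simp add: r_def[abs_def])
    moreover have "DERIV (\<lambda>s. exp (- k * (\<psi> a + s))) s :> - k * exp (- k * (\<psi> a + s))" for a s
      by (auto intro!: derivative_eq_intros)
    ultimately have E': "GDERIV (E a) x :> (- k * E a x) *\<^sub>R ((1 / r a x) *\<^sub>R (x - a))" for a
      unfolding E_def[abs_def] by (rule GDERIV_DERIV_compose)
    have "GDERIV Z x :> (\<Sum>a\<in>N. (- k * E a x) *\<^sub>R ((1 / r a x) *\<^sub>R (x - a)))"
      unfolding Z_def[abs_def] gderiv_def inner_sum_right
      by (intro has_derivative_sum) (use E' in \<open>simp add: gderiv_def\<close>)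
    moreover have "DERIV (\<lambda>z. - ln z / k) (Z x) :> - (1 / (k * Z x))"
      using Z_pos[of x] k by (auto intro!: derivative_eq_intros)
    ultimately show ?thesis
      unfolding F_def[abs_def] G_def by (rule GDERIV_DERIV_compose)
  qed
  moreover have "continuous_on UNIV G"
    unfolding G_def[abs_def] Z_def E_def r_def
    using Z_pos[unfolded Z_def E_def r_def] r_pos[unfolded r_def] k
    by (intro continuous_intros) (auto simp: less_imp_neq[symmetric])
  moreover have "norm (G x) \<le> 1" for x
  proof -
    have "norm (\<Sum>a\<in>N. (- k * E a x) *\<^sub>R ((1 / r a x) *\<^sub>R (x - a))) \<le> (\<Sum>a\<in>N. k * E a x)"
    proof (rule sum_norm_le)
      fix a
      have "norm (x - a) / r a x \<le> 1"
        using r_ge[of x a] r_pos[of a x] by simp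
      then show "norm ((- k * E a x) *\<^sub>R ((1 / r a x) *\<^sub>R (x - a))) \<le> k * E a x"
        using k E_pos[of a x] r_pos[of a x] mult_left_mono[of "norm (x - a) / r a x" 1 "k * E a x"]
        by (simp add: abs_mult)
    qed
    also have "\<dots> = k * Z x" by (simp add: Z_def sum_distrib_left)
    finally show ?thesis
      using k Z_pos[of x] unfolding G_def by (simp add: abs_mult field_simps)
  qed
  moreover have "\<bar>F x - \<psi> x\<bar> \<le> e" if x: "x \<in> K" for x
  proof -
    have lip: "\<bar>\<psi> x - \<psi> a\<bar> \<le> norm (x - a)" if "a \<in> N" for a
      using lipschitz_onD[OF \<psi> x, of a] that N by (auto simp: dist_norm)
    obtain a where a: "a \<in> N" "norm (x - a) < d"
      using N(3) x by (auto simp: dist_norm norm_minus_commute)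
    have "r a x \<le> norm (x - a) + d"
      unfolding r_def dot_square_norm using d by (intro order_trans[OF sqrt_add_le_add_sqrt]) auto
    then have "\<psi> a + r a x \<le> \<psi> x + 3 * d"
      using lip[OF a(1)] a(2) by linarith
    moreover have "F x \<le> \<psi> a + r a x"
    proof -
      have "E a x \<le> Z x"
        unfolding Z_def using a N E_pos by (intro member_le_sum) (auto intro: less_imp_le)
      then have "- k * (\<psi> a + r a x) \<le> ln (Z x)"
        using Z_pos[of x] by (simp add: E_def ln_ge_iff)
      then show ?thesis using k by (simp add: F_def field_simps)
    qed
    \<comment> \<open>Every smoothed cone lies above \<open>\<psi>\<close>, so each of the
      \<open>card N\<close> terms is at most \<open>exp (- k * \<psi> x)\<close>; the logarithm
      turns their number into the error \<open>ln (card N) / k\<close>.\<close>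
    moreover have "\<psi> x - d \<le> F x"
    proof -
      have "Z x \<le> (\<Sum>a\<in>N. exp (- k * \<psi> x))"
        unfolding Z_def E_def
      proof (intro sum_mono)
        fix a assume "a \<in> N"
        then have "\<psi> x \<le> \<psi> a + r a x" using lip[of a] r_ge[of x a] by linarith
        then show "exp (- k * (\<psi> a + r a x)) \<le> exp (- k * \<psi> x)" using k by simp
      qed
      then have "ln (Z x) \<le> ln (card N * exp (- k * \<psi> x))"
        using Z_pos[of x] by simp
      also have "\<dots> = ln (card N) - k * \<psi> x"
        using card by (simp add: ln_mult)
      finally have "\<psi> x - ln (card N) / k \<le> F x"
        using k divide_right_mono[of "k * \<psi> x - ln (card N)" "- ln (Z x)" k]
        by (simp add: F_def diff_divide_distrib)
      then show ?thesis using k(2) by linarith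
    qed
    ultimately show ?thesis using d by linarith
  qed
  ultimately show thesis by (rule that)
qed

text \<open>The Jordan parts inherit concentration on \<open>S\<close>. This reconciles the integral
  over the boundary in the divergence constraint with the integral over the closure in the dual
  problem.\<close>

lemma signed_integral_restrict:
  assumes \<mu>: "\<mu> \<in> vmeasures_on S" and S: "S \<in> sets borel" "S \<subseteq> K"
    and g: "set_borel_measurable borel K g"
  shows "signed_integral K \<mu> g = signed_integral S \<mu> g"
proof -
  have *: "(LINT x:K|M. g x) = (LINT x:S|M. g x)"
    if M: "sets M = sets borel" "emeasure M (- S) = 0" for M
    unfolding set_lebesgue_integral_def
  proof (rule integral_cong_AE)
    have gK: "(\<lambda>x. indicat_real K x *\<^sub>R g x) \<in> borel_measurable M"
      using g by (simp add: set_borel_measurable_def measurable_cong_sets[OF M(1) refl])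
    then show "(\<lambda>x. indicat_real K x *\<^sub>R g x) \<in> borel_measurable M" .
    have "(\<lambda>x. indicat_real S x *\<^sub>R (indicat_real K x *\<^sub>R g x)) \<in> borel_measurable M"
      using S M by (intro borel_measurable_scaleR[OF _ gK]) auto
    moreover have "(\<lambda>x. indicat_real S x *\<^sub>R (indicat_real K x *\<^sub>R g x)) = (\<lambda>x. indicat_real S x *\<^sub>R g x)"
      using S by (auto simp: indicator_def fun_eq_iff)
    ultimately show "(\<lambda>x. indicat_real S x *\<^sub>R g x) \<in> borel_measurable M" by simp
    have "AE x in M. x \<in> S"
      using M S by (intro AE_I[of _ _ "- S"]) auto
    then show "AE x in M. indicat_real K x *\<^sub>R g x = indicat_real S x *\<^sub>R g x"
      by eventually_elim (use S in \<open>auto simp: indicator_def\<close>)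
  qed
  have "emeasure (pos_part \<mu>) (- S) = 0" "emeasure (neg_part \<mu>) (- S) = 0"
    using S by (auto intro!: emeasure_pos_part_outside[OF \<mu>] emeasure_neg_part_outside[OF \<mu>])
  then show ?thesis
    unfolding signed_integral_def by (simp add: *)
qed

lemma dual_le_beckmann:
  fixes \<Omega> :: "'a::euclidean_space set"
  assumes \<Omega>: "bounded \<Omega>" and f: "f \<in> vmeasures_on (frontier \<Omega>)"
    and v: "v \<in> beckmann_flows \<Omega> f" and \<psi>: "\<psi> \<in> Lip1 \<Omega>"
  shows "ereal (signed_integral (closure \<Omega>) f \<psi>) \<le> total_variation (closure \<Omega>) v"
\<comment> \<open>Smoothing needs a nonempty net. In the empty case the dual value is 0, and the
  empty partition shows that the variation is at least 0.\<close>
proof (cases "closure \<Omega> = {}")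
  case True
  have "ereal 0 \<le> total_variation {} v"
    unfolding total_variation_def by (rule SUP_upper2[of "{}"]) (auto simp: partition_on_def)
  then show ?thesis
    unfolding True by (simp add: signed_integral_def set_lebesgue_integral_def zero_ereal_def)
next
  case False
  let ?K = "closure \<Omega>"
  have K: "compact ?K" using \<Omega> by simp
  have vK: "v \<in> vmeasures_on ?K"
    and div: "\<And>\<phi> G. C1_closure \<Omega> \<phi> G \<Longrightarrow> vector_integral ?K v G = signed_integral (frontier \<Omega>) f \<phi>"
    using v by (auto simp: beckmann_flows_def)
  have lip: "1-lipschitz_on ?K \<psi>" using \<psi> by (simp add: Lip1_def)
  define V where "V = measure (pos_part f) ?K + measure (neg_part f) ?K"
  have V: "V \<ge> 0" by (simp add: V_def)
  show ?thesis
  proof (rule ereal_le_epsilon2)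
    fix e :: real assume "e > 0"
    then have "e / (V + 1) > 0" "e / (V + 1) * V \<le> e" using V by (auto simp: field_simps)
    then obtain F G where FG: "\<And>x. GDERIV F x :> G x" "continuous_on UNIV G" "\<And>x. norm (G x) \<le> 1"
        and close: "\<And>x. x \<in> ?K \<Longrightarrow> \<bar>F x - \<psi> x\<bar> \<le> e / (V + 1)"
      using lipschitz_C1_approximation[OF K False lip] by metis
    have "continuous_on UNIV F"
      using FG(1) unfolding gderiv_def
      by (metis continuous_at_imp_continuous_on has_derivative_continuous)
    then have F: "continuous_on ?K F" by (rule continuous_on_subset) simp
    have G: "continuous_on ?K G" using FG(2) by (rule continuous_on_subset) simp
    note mF = continuous_on_compact_measurable_bounded[OF K F]
    note m\<psi> = continuous_on_compact_measurable_bounded[OF K lipschitz_on_continuous_on[OF lip]]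
    have "\<bar>signed_integral ?K f F - signed_integral ?K f \<psi>\<bar> \<le> e / (V + 1) * V"
      unfolding V_def using signed_integral_diff_bound[OF f _ mF m\<psi> close, unfolded V_def] by simp
    then have "signed_integral ?K f \<psi> \<le> signed_integral ?K f F + e"
      using \<open>e / (V + 1) * V \<le> e\<close> by linarith
    also have "signed_integral ?K f F = signed_integral (frontier \<Omega>) f F"
      using mF by (intro signed_integral_restrict[OF f]) (auto simp: frontier_def)
    also have "\<dots> = vector_integral ?K v G"
      using FG F G by (intro div[symmetric]) (simp add: C1_closure_def)
    finally have "ereal (signed_integral ?K f \<psi>) \<le> ereal (vector_integral ?K v G) + ereal e" by simp
    also have "\<dots> \<le> total_variation ?K v + ereal e"
      using FG by (intro add_right_mono vector_integral_le_total_variation[OF vK K G])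
    finally show "ereal (signed_integral ?K f \<psi>) \<le> total_variation ?K v + ereal e" .
  qed
qed

section \<open>The flow of a transport plan\<close>

text \<open>The pushforward under \<open>z\<close> of the vector measure with density
  \<open>h\<close> with respect to \<open>M\<close>, restricted to \<open>K\<close>. The value 0 off
  the Borel sets matches \<open>vmeasures_on\<close>, so that equality of measures is equality of
  functions.\<close>

definition image_vmeasure ::
    "'p measure \<Rightarrow> ('p \<Rightarrow> 'a::topological_space) \<Rightarrow> ('p \<Rightarrow> 'b::euclidean_space) \<Rightarrow> 'a set \<Rightarrow> 'a set \<Rightarrow> 'b" where
  "image_vmeasure M z h K A =
     (if A \<in> sets borel then LINT p|M. indicator (A \<inter> K) (z p) *\<^sub>R h p else 0)"

lemma integrable_indicator_scaleR:
  fixes h :: "'p \<Rightarrow> 'b::euclidean_space"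
  assumes z: "z \<in> M \<rightarrow>\<^sub>M borel" and h: "integrable M h" and A: "A \<in> sets borel"
  shows "integrable M (\<lambda>p. indicat_real A (z p) *\<^sub>R h p)"
proof (rule Bochner_Integration.integrable_bound[OF h])
  have [measurable]: "z \<in> M \<rightarrow>\<^sub>M borel" "h \<in> borel_measurable M" "A \<in> sets borel"
    using z h A by auto
  show "(\<lambda>p. indicat_real A (z p) *\<^sub>R h p) \<in> borel_measurable M" by measurable
qed (simp add: indicator_def)

lemma image_vmeasure_in_vmeasures_on:
  fixes h :: "'p \<Rightarrow> 'b::euclidean_space"
  assumes z: "z \<in> M \<rightarrow>\<^sub>M borel" and h: "integrable M h" and K: "K \<in> sets borel"
  shows "image_vmeasure M z h K \<in> vmeasures_on K"
  unfolding vmeasures_on_def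
proof (intro CollectI conjI allI impI ballI)
  fix A :: "nat \<Rightarrow> 'a set"
  assume A: "range A \<subseteq> sets borel" "disjoint_family A"
  have Ai [measurable]: "A i \<inter> K \<in> sets borel" for i using A K by auto
  have Un: "(\<Union>i\<in>I. A i) \<inter> K \<in> sets borel" for I :: "nat set"
    using A K by auto
  have [measurable]: "z \<in> M \<rightarrow>\<^sub>M borel" "h \<in> borel_measurable M" "K \<in> sets borel"
    using z h K by auto
  have part: "(\<Sum>i<n. image_vmeasure M z h K (A i)) =
      (LINT p|M. indicat_real ((\<Union>i<n. A i) \<inter> K) (z p) *\<^sub>R h p)" for n
  proof -
    have "(\<Sum>i<n. image_vmeasure M z h K (A i)) =
        (LINT p|M. (\<Sum>i<n. indicat_real (A i \<inter> K) (z p) *\<^sub>R h p))"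
      unfolding Bochner_Integration.integral_sum[OF integrable_indicator_scaleR[OF z h Ai]]
      using A(1) by (intro sum.cong refl) (auto simp: image_vmeasure_def)
    also have "(\<lambda>p. (\<Sum>i<n. indicat_real (A i \<inter> K) (z p) *\<^sub>R h p)) =
        (\<lambda>p. indicat_real ((\<Union>i<n. A i) \<inter> K) (z p) *\<^sub>R h p)"
    proof
      fix p
      have "indicat_real (\<Union>i<n. A i \<inter> K) (z p) = (\<Sum>i<n. indicat_real (A i \<inter> K) (z p))"
        using A(2) by (intro indicator_UN_disjoint) (auto simp: disjoint_family_on_def)
      then show "(\<Sum>i<n. indicat_real (A i \<inter> K) (z p) *\<^sub>R h p) =
          indicat_real ((\<Union>i<n. A i) \<inter> K) (z p) *\<^sub>R h p"
        by (simp add: scaleR_sum_left)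
    qed
    finally show ?thesis .
  qed
  have "(\<lambda>n. LINT p|M. indicat_real ((\<Union>i<n. A i) \<inter> K) (z p) *\<^sub>R h p) \<longlonglongrightarrow>
      (LINT p|M. indicat_real ((\<Union>i. A i) \<inter> K) (z p) *\<^sub>R h p)"
  proof (rule integral_dominated_convergence[where w = "\<lambda>p. norm (h p)"])
    show "AE p in M. (\<lambda>n. indicat_real ((\<Union>i<n. A i) \<inter> K) (z p) *\<^sub>R h p) \<longlonglongrightarrow>
        indicat_real ((\<Union>i. A i) \<inter> K) (z p) *\<^sub>R h p"
      unfolding indicator_inter_arith
      by (intro AE_I2 tendsto_intros LIMSEQ_indicator_UN)
    show "AE p in M. norm (indicat_real ((\<Union>i<n. A i) \<inter> K) (z p) *\<^sub>R h p) \<le> norm (h p)" for n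
      by (simp add: indicator_def)
    show "(\<lambda>p. indicat_real ((\<Union>i<n. A i) \<inter> K) (z p) *\<^sub>R h p) \<in> borel_measurable M" for n
      using integrable_indicator_scaleR[OF z h Un] by (rule borel_measurable_integrable)
    show "(\<lambda>p. indicat_real ((\<Union>i. A i) \<inter> K) (z p) *\<^sub>R h p) \<in> borel_measurable M"
      using integrable_indicator_scaleR[OF z h Un] by (rule borel_measurable_integrable)
  qed (use h in auto)
  then show "(\<lambda>n. image_vmeasure M z h K (A n)) sums image_vmeasure M z h K (\<Union>n. A n)"
    using A unfolding sums_def part by (simp add: image_vmeasure_def sets.countable_UN)
qed (use K in \<open>auto simp: image_vmeasure_def\<close>)

text \<open>Change of variables for one coordinate. \<open>N 1\<close> and \<open>N (- 1)\<close>
  are the images of the positive and negative parts of its density. They need not be the Jordan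
  parts, since opposite contributions may meet at the same point, hence the use of
  \<open>signed_integral_eq\<close>.\<close>

lemma signed_integral_image_vmeasure:
  fixes h :: "'p \<Rightarrow> 'b::euclidean_space"
  assumes z: "z \<in> M \<rightarrow>\<^sub>M borel" and h: "integrable M h" and K: "K \<in> sets borel"
    and g: "set_borel_measurable borel K g" "bounded (g ` K)"
  shows "signed_integral K (\<lambda>A. image_vmeasure M z h K A \<bullet> b) g =
    (LINT p|M. indicat_real K (z p) * g (z p) * (h p \<bullet> b))"
proof -
  define k where "k p = indicat_real K (z p) * (h p \<bullet> b)" for p
  have [measurable]: "z \<in> M \<rightarrow>\<^sub>M borel" "h \<in> borel_measurable M" "K \<in> sets borel"
    using z h K by auto
  have ki: "integrable M k"
    using integrable_inner_left[OF integrable_indicator_scaleR[OF z h K], of b]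
    by (simp add: k_def[abs_def])
  then have [measurable]: "k \<in> borel_measurable M" by auto
  define N where "N s = distr (density M (\<lambda>p. ennreal (max 0 (s * k p)))) borel z" for s :: real
  have N_sets: "sets (N s) = sets borel" "space (N s) = UNIV" for s by (auto simp: N_def)
  have N_int: "(LINT x|N s. u x) = (LINT p|M. max 0 (s * k p) * u (z p))"
    if "u \<in> borel_measurable borel" for u :: "'a \<Rightarrow> real" and s
  proof -
    have [measurable]: "u \<in> borel_measurable borel" by fact
    have "(LINT x|N s. u x) = (LINT p|density M (\<lambda>p. ennreal (max 0 (s * k p))). u (z p))"
      unfolding N_def by (rule integral_distr) measurable
    also have "\<dots> = (LINT p|M. max 0 (s * k p) *\<^sub>R u (z p))"
      by (rule integral_density) auto
    finally show ?thesis by simp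
  qed
  have maxi: "integrable M (\<lambda>p. max 0 (s * k p) * u (z p))"
    if "u \<in> borel_measurable borel" "\<And>x. \<bar>u x\<bar> \<le> C" for u :: "'a \<Rightarrow> real" and s C
  proof (rule Bochner_Integration.integrable_bound[of M "\<lambda>p. C * (s * k p)"])
    have [measurable]: "u \<in> borel_measurable borel" by fact
    show "(\<lambda>p. max 0 (s * k p) * u (z p)) \<in> borel_measurable M" by measurable
    show "AE p in M. norm (max 0 (s * k p) * u (z p)) \<le> norm (C * (s * k p))"
    proof (rule AE_I2)
      fix p
      have "\<bar>max 0 (s * k p)\<bar> * \<bar>u (z p)\<bar> \<le> \<bar>s * k p\<bar> * \<bar>C\<bar>"
        using that(2)[of "z p"] by (intro mult_mono) auto
      then show "norm (max 0 (s * k p) * u (z p)) \<le> norm (C * (s * k p))"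
        by (simp add: abs_mult mult_ac)
    qed
  qed (use ki in auto)
  have diff: "(LINT x|N 1. u x) - (LINT x|N (- 1). u x) = (LINT p|M. k p * u (z p))"
    if "u \<in> borel_measurable borel" "\<And>x. \<bar>u x\<bar> \<le> C" for u :: "'a \<Rightarrow> real" and C
  proof -
    have "(LINT x|N 1. u x) - (LINT x|N (- 1). u x) =
      (LINT p|M. max 0 (1 * k p) * u (z p) - max 0 (- 1 * k p) * u (z p))"
      unfolding N_int[OF that(1)]
      by (rule Bochner_Integration.integral_diff[symmetric]) (rule maxi[OF that])+
    also have "\<dots> = (LINT p|M. k p * u (z p))"
      by (intro Bochner_Integration.integral_cong refl) (auto simp: max_def)
    finally show ?thesis .
  qed
  have N_fin: "finite_measure (N s)" for s
  proof (rule finite_measureI)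
    have "emeasure (N s) UNIV = (\<integral>\<^sup>+p. ennreal (max 0 (s * k p)) \<partial>M)"
      by (simp add: N_def emeasure_distr emeasure_density nn_integral_indicator_finite cong: nn_integral_cong_simp)
    also have "\<dots> \<le> (\<integral>\<^sup>+p. ennreal (norm (s * k p)) \<partial>M)"
      by (intro nn_integral_mono ennreal_leI) auto
    also have "\<dots> < \<infinity>"
      using integrable_mult_right[OF ki, of s] by (simp only: integrable_iff_bounded)
    finally show "emeasure (N s) (space (N s)) \<noteq> \<infinity>" by (simp add: N_sets)
  qed
  have "signed_integral K (\<lambda>A. image_vmeasure M z h K A \<bullet> b) g = (LINT x:K|N 1. g x) - (LINT x:K|N (- 1). g x)"
  proof (rule signed_integral_eq[OF _ N_fin N_fin N_sets(1) N_sets(1) _ g])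
    show "(\<lambda>A. image_vmeasure M z h K A \<bullet> b) \<in> vmeasures_on K"
      by (intro vmeasures_on_inner image_vmeasure_in_vmeasures_on z h K)
    fix A :: "'a set" assume A: "A \<in> sets borel"
    then have AK: "A \<inter> K \<in> sets borel" using K by auto
    have "image_vmeasure M z h K A \<bullet> b = (LINT p|M. k p * indicat_real A (z p))"
      using A integral_inner_left[OF integrable_indicator_scaleR[OF z h AK], of b]
      by (simp add: image_vmeasure_def k_def indicator_inter_arith mult_ac)
    also have "\<dots> = (LINT x|N 1. indicat_real A x) - (LINT x|N (- 1). indicat_real A x)"
      using A by (intro diff[symmetric, of _ 1]) (auto simp: indicator_def)
    finally show "image_vmeasure M z h K A \<bullet> b = measure (N 1) A - measure (N (- 1)) A"
      using A by (simp add: N_sets)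
  qed
  also have "\<dots> = (LINT p|M. k p * (indicat_real K (z p) *\<^sub>R g (z p)))"
  proof -
    obtain C where C: "\<And>x. x \<in> K \<Longrightarrow> \<bar>g x\<bar> \<le> C" using g(2) by (auto simp: bounded_iff)
    have "\<bar>indicat_real K x *\<^sub>R g x\<bar> \<le> max 0 C" for x
      using C[of x] by (auto simp: indicator_def)
    then show ?thesis
      unfolding set_lebesgue_integral_def
      using g(1) by (intro diff) (auto simp: set_borel_measurable_def)
  qed
  also have "\<dots> = (LINT p|M. indicat_real K (z p) * g (z p) * (h p \<bullet> b))"
    by (intro Bochner_Integration.integral_cong refl) (auto simp: k_def indicator_def)
  finally show ?thesis .
qed

lemma integrable_bounded_mult_inner:
  fixes h :: "'p \<Rightarrow> 'b::euclidean_space" and g :: "'a::t2_space \<Rightarrow> real"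
  assumes z: "z \<in> M \<rightarrow>\<^sub>M borel" and h: "integrable M h" and K: "compact K" and g: "continuous_on K g"
  shows "integrable M (\<lambda>p. indicat_real K (z p) * g (z p) * (h p \<bullet> b))"
proof -
  obtain C where C: "\<And>x. x \<in> K \<Longrightarrow> \<bar>g x\<bar> \<le> C"
    using continuous_on_compact_measurable_bounded(2)[OF K g] by (auto simp: bounded_iff)
  have [measurable]: "(\<lambda>x. indicat_real K x * g x) \<in> borel_measurable borel"
    using continuous_on_compact_measurable_bounded(1)[OF K g] by (simp add: set_borel_measurable_def)
  have [measurable]: "z \<in> M \<rightarrow>\<^sub>M borel" "h \<in> borel_measurable M"
    using z h by auto
  have m: "(\<lambda>p. (\<lambda>x. indicat_real K x * g x) (z p)) \<in> borel_measurable M" by measurable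
  show ?thesis
  proof (rule Bochner_Integration.integrable_bound[of M "\<lambda>p. C * (h p \<bullet> b)"])
    show "integrable M (\<lambda>p. C * (h p \<bullet> b))" using h by auto
    show "(\<lambda>p. indicat_real K (z p) * g (z p) * (h p \<bullet> b)) \<in> borel_measurable M"
      using m by measurable
    show "AE p in M. norm (indicat_real K (z p) * g (z p) * (h p \<bullet> b)) \<le> norm (C * (h p \<bullet> b))"
    proof (rule AE_I2)
      fix p
      have "\<bar>indicat_real K (z p) * g (z p)\<bar> \<le> \<bar>C\<bar>"
        using C[of "z p"] by (auto simp: indicator_def)
      then show "norm (indicat_real K (z p) * g (z p) * (h p \<bullet> b)) \<le> norm (C * (h p \<bullet> b))"
        unfolding real_norm_def abs_mult[of _ "h p \<bullet> b"] by (intro mult_right_mono) auto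
    qed
  qed
qed

lemma vector_integral_image_vmeasure:
  fixes h :: "'p \<Rightarrow> 'b::euclidean_space" and K :: "'a::t2_space set"
  assumes z: "z \<in> M \<rightarrow>\<^sub>M borel" and h: "integrable M h" and K: "compact K"
    and \<xi>: "continuous_on K \<xi>"
  shows "vector_integral K (image_vmeasure M z h K) \<xi> =
      (LINT p|M. (indicat_real K (z p) *\<^sub>R \<xi> (z p)) \<bullet> h p)"
    and "integrable M (\<lambda>p. (indicat_real K (z p) *\<^sub>R \<xi> (z p)) \<bullet> h p)"
proof -
  have c: "continuous_on K (\<lambda>x. \<xi> x \<bullet> b)" for b by (intro continuous_intros \<xi>)
  note i = integrable_bounded_mult_inner[OF z h K c]
  have eq: "(\<Sum>b\<in>Basis. indicat_real K (z p) * (\<xi> (z p) \<bullet> b) * (h p \<bullet> b)) =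
      (indicat_real K (z p) *\<^sub>R \<xi> (z p)) \<bullet> h p" for p
    by (simp add: euclidean_inner[of "\<xi> (z p)" "h p"] sum_distrib_left mult.assoc)
  show "integrable M (\<lambda>p. (indicat_real K (z p) *\<^sub>R \<xi> (z p)) \<bullet> h p)"
    unfolding eq[symmetric] by (intro Bochner_Integration.integrable_sum i)
  have "vector_integral K (image_vmeasure M z h K) \<xi> =
      (\<Sum>b\<in>Basis. LINT p|M. indicat_real K (z p) * (\<xi> (z p) \<bullet> b) * (h p \<bullet> b))"
    unfolding vector_integral_def
    using continuous_on_compact_measurable_bounded[OF K c]
    by (intro sum.cong refl signed_integral_image_vmeasure z h borel_compact K)
  also have "\<dots> = (LINT p|M. (indicat_real K (z p) *\<^sub>R \<xi> (z p)) \<bullet> h p)"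
    unfolding eq[symmetric] by (intro Bochner_Integration.integral_sum[symmetric] i)
  finally show "vector_integral K (image_vmeasure M z h K) \<xi> =
      (LINT p|M. (indicat_real K (z p) *\<^sub>R \<xi> (z p)) \<bullet> h p)" .
qed

text \<open>The triangle inequality on each piece of a partition. Equality may fail, because values
  of \<open>h\<close> over the same point can cancel.\<close>

lemma total_variation_image_vmeasure:
  fixes h :: "'p \<Rightarrow> 'b::euclidean_space"
  assumes z: "z \<in> M \<rightarrow>\<^sub>M borel" and h: "integrable M h" and K: "K \<in> sets borel"
  shows "total_variation K (image_vmeasure M z h K) \<le> ereal (LINT p|M. norm (h p))"
  unfolding total_variation_def
proof (rule SUP_least)
  fix P :: "'a set set"
  assume P: "P \<in> {P. finite P \<and> P \<subseteq> sets borel \<and> partition_on K P}"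
  then have fin: "finite P" and dis: "disjoint_family_on (\<lambda>A. A) P" and Un: "\<Union>P = K"
    by (auto simp: partition_on_def disjoint_family_on_def disjoint_def)
  have AK: "A \<in> sets borel" "A \<inter> K = A" if "A \<in> P" for A
    using that P Un by auto
  note i = integrable_indicator_scaleR[OF z h]
  note ni = integrable_indicator_scaleR[OF z integrable_norm[OF h]]
  have "(\<Sum>A\<in>P. norm (image_vmeasure M z h K A)) \<le> (\<Sum>A\<in>P. LINT p|M. indicat_real A (z p) *\<^sub>R norm (h p))"
  proof (rule sum_mono)
    fix A assume A: "A \<in> P"
    have "norm (image_vmeasure M z h K A) \<le> (LINT p|M. norm (indicat_real A (z p) *\<^sub>R h p))"
      using AK[OF A] by (simp add: image_vmeasure_def integral_norm_bound del: norm_scaleR)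
    then show "norm (image_vmeasure M z h K A) \<le> (LINT p|M. indicat_real A (z p) *\<^sub>R norm (h p))"
      by simp
  qed
  also have "\<dots> = (LINT p|M. (\<Sum>A\<in>P. indicat_real A (z p) *\<^sub>R norm (h p)))"
    using AK by (intro Bochner_Integration.integral_sum[symmetric] ni) auto
  also have "\<dots> = (LINT p|M. indicat_real K (z p) *\<^sub>R norm (h p))"
  proof (intro Bochner_Integration.integral_cong refl)
    fix p
    have "indicat_real K (z p) = (\<Sum>A\<in>P. indicat_real A (z p))"
      using indicator_UN_disjoint[OF fin dis, of "z p"] Un by simp
    then show "(\<Sum>A\<in>P. indicat_real A (z p) *\<^sub>R norm (h p)) = indicat_real K (z p) *\<^sub>R norm (h p)"
      by (simp add: sum_distrib_right)
  qed
  also have "\<dots> \<le> (LINT p|M. norm (h p))"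
    by (intro integral_mono ni K integrable_norm h) (auto simp: indicator_def)
  finally show "ereal (\<Sum>A\<in>P. norm (image_vmeasure M z h K A)) \<le> ereal (LINT p|M. norm (h p))"
    by simp
qed

lemma transport_plansD:
  assumes "\<gamma> \<in> transport_plans K \<mu> \<nu>"
  shows "finite_measure \<gamma>" "sets \<gamma> = sets borel" "space \<gamma> = UNIV" "emeasure \<gamma> (- (K \<times> K)) = 0"
    "distr \<gamma> borel fst = \<mu>" "distr \<gamma> borel snd = \<nu>"
  using assms sets_eq_imp_space_eq[of \<gamma> borel] by (auto simp: transport_plans_def)

lemma AE_in_Times:
  fixes K :: "'a::euclidean_space set"
  assumes "\<gamma> \<in> transport_plans K \<mu> \<nu>" and "compact K"
  shows "AE q in \<gamma>. q \<in> K \<times> K"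
proof (rule AE_I[of _ _ "- (K \<times> K)"])
  show "- (K \<times> K) \<in> sets \<gamma>"
    unfolding transport_plansD(2)[OF assms(1)]
    using assms(2) by (intro borel_comp borel_compact compact_Times)
qed (use transport_plansD(4)[OF assms(1)] in auto)

text \<open>A probability measure on all Borel sets of the line, rather than a measure on the
  interval as a space, so that its product with a plan lives on the Borel sets of the product
  space.\<close>

definition unit_interval_measure :: "real measure" where
  "unit_interval_measure = density lborel (\<lambda>t. ennreal (indicator {0..1} t))"

lemma sets_unit_interval_measure [simp, measurable_cong]: "sets unit_interval_measure = sets borel"
  by (simp add: unit_interval_measure_def)

lemma emeasure_unit_interval_measure: "emeasure unit_interval_measure UNIV = 1"
proof -
  have "emeasure unit_interval_measure UNIV = emeasure lborel {0..1::real}"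
    by (simp add: unit_interval_measure_def emeasure_density ennreal_indicator)
  then show ?thesis by simp
qed

lemma finite_measure_unit_interval_measure: "finite_measure unit_interval_measure"
  using emeasure_unit_interval_measure
  by (intro finite_measureI) (simp add: unit_interval_measure_def)

lemma integral_unit_interval_measure:
  fixes g :: "real \<Rightarrow> real"
  assumes "g \<in> borel_measurable borel"
  shows "(LINT t|unit_interval_measure. g t) = (LINT t:{0..1}|lborel. g t)"
  unfolding unit_interval_measure_def set_lebesgue_integral_def
  using assms by (intro integral_density) auto

definition segment_point :: "('a \<times> 'a) \<times> real \<Rightarrow> 'a::real_vector" where
  "segment_point p = (1 - snd p) *\<^sub>R fst (fst p) + snd p *\<^sub>R snd (fst p)"

text \<open>The cutoff bounds the displacement by the diameter of \<open>K\<close> everywhere, which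
  makes it integrable; plans charge only \<open>K \<times> K\<close>, so nothing is lost.\<close>

definition displacement :: "'a set \<Rightarrow> ('a \<times> 'a) \<times> real \<Rightarrow> 'a::real_vector" where
  "displacement K p = indicator (K \<times> K) (fst p) *\<^sub>R (snd (fst p) - fst (fst p))"

lemma
  fixes K :: "'a::euclidean_space set"
  assumes \<gamma>: "\<gamma> \<in> transport_plans K \<mu> \<nu>" and K: "compact K"
  shows segment_point_measurable: "segment_point \<in> \<gamma> \<Otimes>\<^sub>M unit_interval_measure \<rightarrow>\<^sub>M borel"
    and integrable_displacement: "integrable (\<gamma> \<Otimes>\<^sub>M unit_interval_measure) (displacement K)"
proof -
  note \<gamma>D = transport_plansD[OF \<gamma>]
  interpret G: finite_measure \<gamma> by (rule \<gamma>D)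
  interpret U: finite_measure unit_interval_measure by (rule finite_measure_unit_interval_measure)
  interpret P: finite_measure "\<gamma> \<Otimes>\<^sub>M unit_interval_measure"
    by (rule finite_measure_pair_measure[OF finite_measure_unit_interval_measure \<gamma>D(1)])
  have s: "sets (\<gamma> \<Otimes>\<^sub>M unit_interval_measure) = sets (borel :: (('a \<times> 'a) \<times> real) measure)"
    by (simp only: sets_pair_measure_cong[OF \<gamma>D(2) sets_unit_interval_measure] borel_prod)
  show "segment_point \<in> \<gamma> \<Otimes>\<^sub>M unit_interval_measure \<rightarrow>\<^sub>M borel"
    unfolding measurable_cong_sets[OF s refl] segment_point_def[abs_def]
    by (intro borel_measurable_continuous_onI continuous_intros)
  have m: "displacement K \<in> borel_measurable borel"
    unfolding displacement_def[abs_def]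
  proof (rule borel_measurable_scaleR)
    have "K \<times> K \<in> sets borel" using K by (intro borel_compact compact_Times)
    moreover have "(fst :: ('a \<times> 'a) \<times> real \<Rightarrow> _) \<in> borel \<rightarrow>\<^sub>M borel"
      by (intro borel_measurable_continuous_onI continuous_intros)
    ultimately show "(\<lambda>p. indicat_real (K \<times> K) (fst p)) \<in> borel_measurable (borel :: (('a \<times> 'a) \<times> real) measure)"
      by (intro measurable_compose[where f = fst and g = "indicat_real (K \<times> K)"]
          borel_measurable_indicator)
    show "(\<lambda>p. snd (fst p) - fst (fst p)) \<in> borel_measurable (borel :: (('a \<times> 'a) \<times> real) measure)"
      by (intro borel_measurable_continuous_onI continuous_intros)
  qed
  show "integrable (\<gamma> \<Otimes>\<^sub>M unit_interval_measure) (displacement K)"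
  proof (rule P.integrable_const_bound[of _ "diameter K"])
    show "AE p in \<gamma> \<Otimes>\<^sub>M unit_interval_measure. norm (displacement K p) \<le> diameter K"
      using diameter_bounded_bound[OF compact_imp_bounded[OF K]] diameter_ge_0[OF compact_imp_bounded[OF K]]
      by (intro AE_I2) (auto simp: displacement_def indicator_def dist_norm norm_minus_commute)
  qed (use m in \<open>simp add: measurable_cong_sets[OF s refl]\<close>)
qed

text \<open>Fubini shows that the image measure has the integrals prescribed in the definition of
  \<open>plan_flow\<close>, and \<open>vmeasures_on_eqI\<close> shows that no other measure on
  \<open>K\<close> has them, so the definite description denotes it.\<close>

lemma
  fixes K :: "'a::euclidean_space set"
  assumes \<gamma>: "\<gamma> \<in> transport_plans K \<mu> \<nu>" and K: "compact K"
  shows plan_flow_eq: "plan_flow K \<gamma> = image_vmeasure (\<gamma> \<Otimes>\<^sub>M unit_interval_measure) segment_point (displacement K) K"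
      (is "_ = ?w")
    and vector_integral_plan_flow: "\<And>\<xi>. continuous_on K \<xi> \<Longrightarrow> vector_integral K (plan_flow K \<gamma>) \<xi> =
        (LINT (x, y):K \<times> K|\<gamma>. LINT t:{0..1}|lborel.
           (let z = (1 - t) *\<^sub>R x + t *\<^sub>R y in (indicator K z *\<^sub>R \<xi> z) \<bullet> (y - x)))"
    and set_integrable_plan_flow: "\<And>\<xi>. continuous_on K \<xi> \<Longrightarrow> set_integrable \<gamma> (K \<times> K)
        (\<lambda>(x, y). LINT t:{0..1}|lborel.
           (let z = (1 - t) *\<^sub>R x + t *\<^sub>R y in (indicator K z *\<^sub>R \<xi> z) \<bullet> (y - x)))"
proof -
  note z = segment_point_measurable[OF \<gamma> K] and h = integrable_displacement[OF \<gamma> K]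
  note \<gamma>D = transport_plansD[OF \<gamma>]
  interpret G: finite_measure \<gamma> by (rule \<gamma>D)
  interpret U: finite_measure unit_interval_measure by (rule finite_measure_unit_interval_measure)
  interpret P: pair_sigma_finite \<gamma> unit_interval_measure ..
  have w: "?w \<in> vmeasures_on K"
    by (intro image_vmeasure_in_vmeasures_on z h borel_compact K)
  have eq: "vector_integral K ?w \<xi> =
        (LINT (x, y):K \<times> K|\<gamma>. LINT t:{0..1}|lborel.
           (let z = (1 - t) *\<^sub>R x + t *\<^sub>R y in (indicator K z *\<^sub>R \<xi> z) \<bullet> (y - x)))"
    and int: "set_integrable \<gamma> (K \<times> K) (\<lambda>(x, y). LINT t:{0..1}|lborel.
           (let z = (1 - t) *\<^sub>R x + t *\<^sub>R y in (indicator K z *\<^sub>R \<xi> z) \<bullet> (y - x)))"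
    if \<xi>: "continuous_on K \<xi>" for \<xi>
  proof -
    define F where "F q t = (indicat_real K (segment_point (q, t)) *\<^sub>R \<xi> (segment_point (q, t))) \<bullet> (snd q - fst q)"
      for q :: "'a \<times> 'a" and t
    have Fm: "F q \<in> borel_measurable borel" for q
    proof -
      have "(\<lambda>x. indicat_real K x *\<^sub>R \<xi> x) \<in> borel_measurable borel"
        by (intro borel_measurable_continuous_on_indicator \<xi> borel_compact K)
      moreover have "(\<lambda>t. segment_point (q, t)) \<in> borel_measurable borel"
        unfolding segment_point_def by (intro borel_measurable_continuous_onI continuous_intros)
      ultimately have "(\<lambda>t. (\<lambda>x. indicat_real K x *\<^sub>R \<xi> x) (segment_point (q, t))) \<in> borel_measurable borel"
        by (rule measurable_compose[rotated])
      then show ?thesis unfolding F_def[abs_def] by (intro borel_measurable_inner) auto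
    qed
    have inner: "(LINT t|unit_interval_measure.
        (indicat_real K (segment_point (q, t)) *\<^sub>R \<xi> (segment_point (q, t))) \<bullet> displacement K (q, t)) =
        indicat_real (K \<times> K) q *\<^sub>R (LINT t:{0..1}|lborel. F q t)" for q
      unfolding integral_unit_interval_measure[OF Fm, symmetric] by (simp add: displacement_def F_def[abs_def])
    have F: "(\<lambda>q. LINT t:{0..1}|lborel. F q t) = (\<lambda>(x, y). LINT t:{0..1}|lborel.
           (let z = (1 - t) *\<^sub>R x + t *\<^sub>R y in (indicator K z *\<^sub>R \<xi> z) \<bullet> (y - x)))"
      by (simp add: F_def segment_point_def Let_def case_prod_beta')
    have "vector_integral K ?w \<xi> = (LINT p|(\<gamma> \<Otimes>\<^sub>M unit_interval_measure).
        (indicat_real K (segment_point p) *\<^sub>R \<xi> (segment_point p)) \<bullet> displacement K p)"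
      by (rule vector_integral_image_vmeasure(1)[OF z h K \<xi>])
    also have "\<dots> = (LINT q|\<gamma>. indicat_real (K \<times> K) q *\<^sub>R (LINT t:{0..1}|lborel. F q t))"
      using P.integral_fst'[OF vector_integral_image_vmeasure(2)[OF z h K \<xi>]] unfolding inner by simp
    finally show "vector_integral K ?w \<xi> = (LINT (x, y):K \<times> K|\<gamma>. LINT t:{0..1}|lborel.
           (let z = (1 - t) *\<^sub>R x + t *\<^sub>R y in (indicator K z *\<^sub>R \<xi> z) \<bullet> (y - x)))"
      unfolding F[symmetric] set_lebesgue_integral_def[of \<gamma>] .
    show "set_integrable \<gamma> (K \<times> K) (\<lambda>(x, y). LINT t:{0..1}|lborel.
           (let z = (1 - t) *\<^sub>R x + t *\<^sub>R y in (indicator K z *\<^sub>R \<xi> z) \<bullet> (y - x)))"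
      using P.integrable_fst'[OF vector_integral_image_vmeasure(2)[OF z h K \<xi>]]
      unfolding inner F[symmetric] set_integrable_def .
  qed
  show w_eq: "plan_flow K \<gamma> = ?w"
    unfolding plan_flow_def
  proof (rule the_equality)
    show "?w \<in> vmeasures_on K \<and>
     (\<forall>\<xi>. continuous_on K \<xi> \<longrightarrow> vector_integral K ?w \<xi> =
        (LINT (x, y):K \<times> K|\<gamma>. LINT t:{0..1}|lborel.
           (let z = (1 - t) *\<^sub>R x + t *\<^sub>R y in (indicator K z *\<^sub>R \<xi> z) \<bullet> (y - x))))"
      using w eq by blast
  qed (use w eq K in \<open>auto intro!: vmeasures_on_eqI[of _ K]\<close>)
  show "\<And>\<xi>. continuous_on K \<xi> \<Longrightarrow> vector_integral K (plan_flow K \<gamma>) \<xi> =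
        (LINT (x, y):K \<times> K|\<gamma>. LINT t:{0..1}|lborel.
           (let z = (1 - t) *\<^sub>R x + t *\<^sub>R y in (indicator K z *\<^sub>R \<xi> z) \<bullet> (y - x)))"
    unfolding w_eq by (rule eq)
  show "\<And>\<xi>. continuous_on K \<xi> \<Longrightarrow> set_integrable \<gamma> (K \<times> K)
        (\<lambda>(x, y). LINT t:{0..1}|lborel.
           (let z = (1 - t) *\<^sub>R x + t *\<^sub>R y in (indicator K z *\<^sub>R \<xi> z) \<bullet> (y - x)))"
    by (rule int)
qed

text \<open>The norm of the displacement does not depend on the position along the segment, so
  integrating over a parameter interval of mass 1 leaves |x - y|.\<close>

lemma total_variation_plan_flow:
  fixes K :: "'a::euclidean_space set"
  assumes \<gamma>: "\<gamma> \<in> transport_plans K \<mu> \<nu>" and K: "compact K"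
  shows "total_variation K (plan_flow K \<gamma>) \<le> transport_cost K \<gamma>"
proof -
  note z = segment_point_measurable[OF \<gamma> K] and h = integrable_displacement[OF \<gamma> K]
  note \<gamma>D = transport_plansD[OF \<gamma>]
  interpret G: finite_measure \<gamma> by (rule \<gamma>D)
  interpret U: finite_measure unit_interval_measure by (rule finite_measure_unit_interval_measure)
  interpret P: pair_sigma_finite \<gamma> unit_interval_measure ..
  have one: "measure unit_interval_measure UNIV = 1"
    using emeasure_unit_interval_measure by (simp add: measure_def)
  have "total_variation K (plan_flow K \<gamma>) \<le>
      ereal (LINT p|(\<gamma> \<Otimes>\<^sub>M unit_interval_measure). norm (displacement K p))"
    unfolding plan_flow_eq[OF \<gamma> K]
    by (intro total_variation_image_vmeasure z h borel_compact K)
  also have "(LINT p|(\<gamma> \<Otimes>\<^sub>M unit_interval_measure). norm (displacement K p)) =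
      (LINT q|\<gamma>. LINT t|unit_interval_measure. norm (displacement K (q, t)))"
    using P.integral_fst'[OF integrable_norm[OF h]] by simp
  also have "\<dots> = (LINT (x, y):K \<times> K|\<gamma>. dist x y)"
    unfolding set_lebesgue_integral_def
    using one
    by (intro Bochner_Integration.integral_cong refl)
      (auto simp: displacement_def dist_norm norm_minus_commute unit_interval_measure_def)
  finally show ?thesis by (simp add: transport_cost_def)
qed

section \<open>Kantorovich duality\<close>

lemma closed_spt: "closed (spt \<mu>)"
proof -
  have "- spt \<mu> = \<Union>{U. open U \<and> emeasure \<mu> U = 0}"
    by (auto simp: spt_def zero_less_iff_neq_zero)
  then have "open (- spt \<mu>)" by (auto intro: open_Union)
  then show ?thesis by (simp add: closed_def)
qed

text \<open>The complement of the support is a union of possibly uncountably many open null sets; by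
  the Lindelof property countably many of them suffice.\<close>

lemma emeasure_outside_spt:
  fixes \<mu> :: "'a::second_countable_topology measure"
  assumes "sets \<mu> = sets borel"
  shows "emeasure \<mu> (- spt \<mu>) = 0"
proof -
  let ?F = "{U. open U \<and> emeasure \<mu> U = 0}"
  obtain F' where F': "F' \<subseteq> ?F" "countable F'" "\<Union>F' = \<Union>?F"
    using Lindelof[of ?F] by auto
  have "(\<Union>U\<in>F'. U) \<in> null_sets \<mu>"
  proof (rule null_sets_UN')
    show "U \<in> null_sets \<mu>" if "U \<in> F'" for U
      using F'(1) that assms by (auto simp: null_sets_def)
  qed (rule F')
  moreover have "- spt \<mu> = \<Union>?F"
    by (auto simp: spt_def zero_less_iff_neq_zero)
  ultimately show ?thesis using F'(3) by (auto simp: null_sets_def)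
qed

lemma spt_subset:
  assumes "closed S" "emeasure \<mu> (- S) = 0"
  shows "spt \<mu> \<subseteq> S"
proof
  fix x assume "x \<in> spt \<mu>"
  then show "x \<in> S"
    using assms by (force simp: spt_def closed_def)
qed

text \<open>The signed length of a path from \<open>a\<close> to \<open>z\<close> through the listed
  pairs: the jumps between consecutive pairs count positively, the pairs themselves negatively. It
  is the quantity minimized in Rockafellar's construction of a potential.\<close>

fun chain_length :: "'a::metric_space \<Rightarrow> ('a \<times> 'a) list \<Rightarrow> 'a \<Rightarrow> real" where
  "chain_length a [] z = dist a z"
| "chain_length a ((x, y) # l) z = dist a x - dist x y + chain_length y l z"

text \<open>Closing the chain with the pair \<open>(x, y)\<close> and moving all pair lengths to the
  left gives the usual form: re-pairing along a cycle does not decrease the total distance.\<close>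

definition cyclically_monotone :: "('a::metric_space \<times> 'a) set \<Rightarrow> bool" where
  "cyclically_monotone S \<longleftrightarrow> (\<forall>(x, y)\<in>S. \<forall>l\<in>lists S. dist x y \<le> chain_length y l x)"

lemma chain_length_lipschitz: "chain_length a l z \<le> chain_length a l z' + dist z z'"
proof (induction l arbitrary: a)
  case Nil
  then show ?case by (simp add: dist_triangle2 dist_commute dist_triangle)
next
  case (Cons p l)
  then show ?case by (cases p) (simp add: add.assoc)
qed

lemma chain_length_snoc:
  "chain_length a (l @ [(x, y)]) z = chain_length a l x - dist x y + dist y z"
proof (induction l arbitrary: a)
  case (Cons p l)
  then show ?case by (cases p) simp
qed simp

text \<open>Rockafellar's construction: the infimum of chain lengths from a base pair. Cyclical
  monotonicity at the base pair keeps the infimum finite, the last leg of a chain makes it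
  1-Lipschitz, and appending a pair of \<open>S\<close> to a chain gives the equality on
  \<open>S\<close>.\<close>

lemma cyclically_monotone_potential:
  fixes S :: "('a::metric_space \<times> 'a) set"
  assumes cm: "cyclically_monotone S"
  obtains \<psi> where "1-lipschitz_on UNIV \<psi>" "\<And>x y. (x, y) \<in> S \<Longrightarrow> \<psi> x - \<psi> y = dist x y"
proof (cases "S = {}")
  case True
  have "1-lipschitz_on UNIV (\<lambda>x::'a. 0::real)" by (rule lipschitz_onI) auto
  then show ?thesis using True that by auto
next
  case False
  then obtain x0 y0 where 0: "(x0, y0) \<in> S" by auto
  define \<psi> where "\<psi> z = (INF l\<in>lists S. chain_length y0 l z)" for z
  have ne: "lists S \<noteq> {}" by auto
  have lower: "dist x0 y0 - dist x0 z \<le> chain_length y0 l z" if "l \<in> lists S" for l z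
  proof -
    have "dist x0 y0 \<le> chain_length y0 l x0"
      using cm 0 that unfolding cyclically_monotone_def by fast
    then show ?thesis using chain_length_lipschitz[of y0 l x0 z] by linarith
  qed
  have bdd: "bdd_below ((\<lambda>l. chain_length y0 l z) ` lists S)" for z
    using lower[of _ z] by (auto intro!: bdd_belowI2)
  have \<psi>_le: "\<psi> z \<le> chain_length y0 l z" if "l \<in> lists S" for l z
    unfolding \<psi>_def using bdd that by (rule cINF_lower)
  have lip: "\<psi> z \<le> \<psi> z' + dist z z'" for z z'
  proof -
    have "\<psi> z - dist z z' \<le> chain_length y0 l z'" if "l \<in> lists S" for l
      using \<psi>_le[OF that, of z] chain_length_lipschitz[of y0 l z z'] by linarith
    then have "\<psi> z - dist z z' \<le> \<psi> z'"
      unfolding \<psi>_def[of z'] using ne by (intro cINF_greatest)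
    then show ?thesis by linarith
  qed
  have "1-lipschitz_on UNIV \<psi>"
  proof (rule lipschitz_onI)
    show "dist (\<psi> x) (\<psi> y) \<le> 1 * dist x y" for x y
      using lip[of x y] lip[of y x] by (simp add: dist_real_def dist_commute abs_le_iff)
  qed simp
  moreover have "\<psi> x - \<psi> y = dist x y" if xy: "(x, y) \<in> S" for x y
  proof -
    have "\<psi> y + dist x y \<le> chain_length y0 l x" if "l \<in> lists S" for l
      \<comment> \<open>After the appended pair the chain has already reached \<open>y\<close>, so
        its last leg has length 0.\<close>
      using \<psi>_le[of "l @ [(x, y)]" y] that xy by (simp add: chain_length_snoc)
    then have "\<psi> y + dist x y \<le> \<psi> x"
      unfolding \<psi>_def[of x] using ne by (intro cINF_greatest)
    then show ?thesis using lip[of x y] by linarith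
  qed
  ultimately show thesis by (rule that)
qed

lemma chain_length_eq_sum_list:
  "chain_length y l z = sum_list (map2 dist (y # map snd l) (map fst l @ [z])) - (\<Sum>(x, y)\<leftarrow>l. dist x y)"
proof (induction l arbitrary: y)
  case (Cons p l)
  then show ?case by (cases p) simp
qed simp

text \<open>The exchange of mass needs sums indexed by position instead of a recursion.
  \<open>rotate1\<close> encodes the new pairing: the second point of each pair goes with the first
  point of the next, cyclically.\<close>

lemma cycle_length_eq_sum:
  assumes "L = (x, y) # l"
  shows "chain_length y l x - dist x y =
    (\<Sum>i<length L. dist (fst (rotate1 L ! i)) (snd (L ! i))) - (\<Sum>i<length L. dist (fst (L ! i)) (snd (L ! i)))"
proof -
  have "sum_list (map2 dist (y # map snd l) (map fst l @ [x])) =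
      (\<Sum>i<length L. map2 dist (map snd L) (map fst (rotate1 L)) ! i)"
    unfolding sum_list_sum_nth using assms by (simp add: atLeast0LessThan)
  also have "\<dots> = (\<Sum>i<length L. dist (fst (rotate1 L ! i)) (snd (L ! i)))"
    by (intro sum.cong refl) (simp add: dist_commute)
  finally have 1: "sum_list (map2 dist (y # map snd l) (map fst l @ [x])) = \<dots>" .
  have "(\<Sum>(x, y)\<leftarrow>L. dist x y) = (\<Sum>i<length L. dist (fst (L ! i)) (snd (L ! i)))"
    unfolding sum_list_sum_nth by (simp add: atLeast0LessThan case_prod_beta')
  then show ?thesis
    unfolding chain_length_eq_sum_list 1 using assms by simp
qed

lemma sum_rotate1:
  fixes h :: "'a \<Rightarrow> 'b::comm_monoid_add"
  shows "(\<Sum>i<length L. h (rotate1 L ! i)) = (\<Sum>i<length L. h (L ! i))"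
proof -
  have *: "(\<Sum>i<length M. h (M ! i)) = sum_list (map h M)" for M
    by (simp add: sum_list_sum_nth atLeast0LessThan)
  have "(\<Sum>i<length L. h (rotate1 L ! i)) = sum_list (map h (rotate1 L))"
    using *[of "rotate1 L"] by simp
  also have "\<dots> = sum_list (map h L)"
    by (cases L) (simp_all add: add.commute)
  finally show ?thesis by (simp add: *)
qed

text \<open>The measure obtained is M - N1 + N2. The conclusion is stated additively to avoid
  truncated subtraction in \<open>ennreal\<close>.\<close>

lemma measure_exchange:
  fixes M N1 N2 :: "'a::topological_space measure"
  assumes fin: "finite_measure M" "finite_measure N1" "finite_measure N2"
    and sets: "sets M = sets borel" "sets N1 = sets borel" "sets N2 = sets borel"
    and le: "\<And>A. A \<in> sets borel \<Longrightarrow> emeasure N1 A \<le> emeasure M A"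
  obtains M' where "finite_measure M'" "sets M' = sets borel"
    "\<And>A. A \<in> sets borel \<Longrightarrow> emeasure M' A + emeasure N1 A = emeasure M A + emeasure N2 A"
proof
  define M' where "M' = sum_measure UNIV (\<lambda>b. if b then diff_measure M N1 else N2)"
  have em: "emeasure M' A = (emeasure M A - emeasure N1 A) + emeasure N2 A" if "A \<in> sets borel" for A
  proof -
    have "emeasure (diff_measure M N1) A = emeasure M A - emeasure N1 A"
      using that sets le by (intro emeasure_diff_measure fin) auto
    then show ?thesis
      unfolding M'_def using that sets
      by (subst emeasure_sum_measure) (auto simp: UNIV_bool add.commute)
  qed
  show "sets M' = sets borel" by (simp add: M'_def)
  show "emeasure M' A + emeasure N1 A = emeasure M A + emeasure N2 A" if A: "A \<in> sets borel" for A
    using le[OF A] unfolding em[OF A]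
    by (simp add: add.assoc add.commute[of "emeasure N2 A"] add.assoc[symmetric] diff_add_cancel_ennreal)
  show "finite_measure M'"
  proof (rule finite_measureI)
    have "emeasure M UNIV - emeasure N1 UNIV \<le> emeasure M UNIV" by (rule diff_le_self_ennreal)
    then show "emeasure M' (space M') \<noteq> \<infinity>"
      using em[of UNIV] finite_measure.emeasure_finite[OF fin(1), of UNIV]
        finite_measure.emeasure_finite[OF fin(3), of UNIV]
      by (auto simp: M'_def top_unique)
  qed
qed

lemma emeasure_pair_measure_outside_Times:
  assumes fin: "finite_measure A" "finite_measure B"
    and S: "S \<in> sets A" "T \<in> sets B" "emeasure A (space A - S) = 0" "emeasure B (space B - T) = 0"
  shows "emeasure (A \<Otimes>\<^sub>M B) (space (A \<Otimes>\<^sub>M B) - S \<times> T) = 0"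
proof -
  interpret A: finite_measure A by fact
  interpret B: finite_measure B by fact
  have "(space A - S) \<times> space B \<in> null_sets (A \<Otimes>\<^sub>M B)" "space A \<times> (space B - T) \<in> null_sets (A \<Otimes>\<^sub>M B)"
    using S by (auto simp: null_sets_def B.emeasure_pair_measure_Times)
  then have "(space A - S) \<times> space B \<union> space A \<times> (space B - T) \<in> null_sets (A \<Otimes>\<^sub>M B)" by (rule null_sets.Un)
  moreover have "space (A \<Otimes>\<^sub>M B) - S \<times> T = (space A - S) \<times> space B \<union> space A \<times> (space B - T)"
    by (auto simp: space_pair_measure)
  ultimately show ?thesis by (auto simp: null_sets_def)
qed

text \<open>If a cycle through the support could be shortened, one moves a small amount of mass near
  its pairs: the restrictions of \<open>\<gamma>\<close> to small boxes around the pairs are replaced by products of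
  their marginals, paired along the cycle.\<close>

lemma optimal_plan_cyclically_monotone:
  fixes K :: "'a::euclidean_space set"
  assumes \<gamma>: "\<gamma> \<in> transport_plans K \<mu> \<nu>" and K: "compact K"
    and opt: "\<And>\<gamma>'. \<gamma>' \<in> transport_plans K \<mu> \<nu> \<Longrightarrow> transport_cost K \<gamma> \<le> transport_cost K \<gamma>'"
  shows "cyclically_monotone (spt \<gamma>)"
proof (rule ccontr)
  note \<gamma>D = transport_plansD[OF \<gamma>]
  interpret finite_measure \<gamma> by (rule \<gamma>D)
  assume "\<not> cyclically_monotone (spt \<gamma>)"
  then obtain x y l where xy: "(x, y) \<in> spt \<gamma>" "l \<in> lists (spt \<gamma>)" "chain_length y l x < dist x y"
    unfolding cyclically_monotone_def by fastforce
  define L where "L = (x, y) # l"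
  define n where "n = length L"
  have n: "n > 0" by (simp add: n_def L_def)
  have L: "L ! i \<in> spt \<gamma>" if "i < n" for i
    using xy that by (auto simp: L_def n_def nth_Cons' in_lists_conv_set)
  define D where "D = (\<Sum>i<n. dist (fst (L ! i)) (snd (L ! i)))"
  define D' where "D' = (\<Sum>i<n. dist (fst (rotate1 L ! i)) (snd (L ! i)))"
  have D: "D' < D"
    using cycle_length_eq_sum[OF L_def] xy(3) by (simp add: D_def D'_def n_def)
  \<comment> \<open>In a box of radius \<open>r\<close> the distance of a pair changes by at most
    \<open>2 * r\<close>. Over n removed and n added masses the error is \<open>4 * r * n\<close>,
    which is half of the gain \<open>D - D'\<close>.\<close>
  define r where "r = (D - D') / (8 * n)"
  have r: "r > 0" "4 * r * n < D - D'"
    using D n by (auto simp: r_def field_simps)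

  \<comment> \<open>Normalized restrictions of the plan to small boxes\<close>
  define E where "E p = ball (fst p) r \<times> ball (snd p) r" for p :: "'a \<times> 'a"
  have E_open: "open (E p)" for p unfolding E_def by (intro open_Times) auto
  then have E_sets: "E p \<in> sets \<gamma>" for p using \<gamma>D(2) by auto
  define m where "m i = measure \<gamma> (E (L ! i))" for i
  have E_pos: "emeasure \<gamma> (E (L ! i)) > 0" if "i < n" for i
  proof -
    have "L ! i \<in> E (L ! i)" using r by (simp add: E_def mem_Times_iff)
    then show ?thesis using L[OF that] E_open unfolding spt_def by blast
  qed
  then have m_pos: "m i > 0" if "i < n" for i
    using that by (simp add: m_def emeasure_eq_measure)
  \<comment> \<open>Normalizing gives every restriction mass 1, so one common factor
    \<open>c\<close> can later be removed from each box and marginals of different boxes can be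
    coupled.\<close>
  define G where "G p = uniform_measure \<gamma> (E p)" for p
  have G_sets: "sets (G p) = sets borel" "space (G p) = UNIV" for p
    using \<gamma>D by (simp_all add: G_def)
  have G_em: "emeasure (G (L ! i)) A = ennreal (measure \<gamma> (E (L ! i) \<inter> A) / m i)"
    if "i < n" "A \<in> sets borel" for i A
    using that m_pos[OF that(1)] E_sets \<gamma>D(2)
    by (simp add: G_def emeasure_eq_measure m_def divide_ennreal)
  have G_1: "emeasure (G (L ! i)) UNIV = 1" if "i < n" for i
    using m_pos[OF that] that by (simp add: G_em m_def)
  have G_fin: "finite_measure (G (L ! i))" if "i < n" for i
    using G_1[OF that] by (intro finite_measureI) (simp add: G_sets)

  \<comment> \<open>Marginals of the restrictions\<close>
  define a where "a p = distr (G p) borel fst" for p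
  define b where "b p = distr (G p) borel snd" for p
  have fst_m: "fst \<in> M \<rightarrow>\<^sub>M borel" and snd_m: "snd \<in> M \<rightarrow>\<^sub>M borel"
    if "sets M = sets borel" for M :: "('a \<times> 'a) measure"
    unfolding measurable_cong_sets[OF that refl]
    by (intro borel_measurable_continuous_onI continuous_intros)+
  have ab_sets: "sets (a p) = sets borel" "space (a p) = UNIV" "sets (b p) = sets borel" "space (b p) = UNIV" for p
    by (simp_all add: a_def b_def)
  have ab_em: "emeasure (a p) A = emeasure (G p) (A \<times> UNIV)" "emeasure (b p) A = emeasure (G p) (UNIV \<times> A)"
    if "A \<in> sets borel" for A p
  proof -
    have "fst -` A = A \<times> (UNIV :: 'a set)" "snd -` A = (UNIV :: 'a set) \<times> A" by auto
    then show "emeasure (a p) A = emeasure (G p) (A \<times> UNIV)" "emeasure (b p) A = emeasure (G p) (UNIV \<times> A)"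
      using that by (simp_all add: a_def b_def emeasure_distr fst_m snd_m G_sets)
  qed
  have ab_1: "emeasure (a (L ! i)) UNIV = 1" "emeasure (b (L ! i)) UNIV = 1" if "i < n" for i
    using G_1[OF that] by (simp_all add: ab_em)
  have ab_fin: "finite_measure (a (L ! i))" "finite_measure (b (L ! i))" if "i < n" for i
    using ab_1[OF that] by (auto intro!: finite_measureI simp: ab_sets)
  have borel_Times: "A \<times> B \<in> sets borel" if "A \<in> sets borel" "B \<in> sets borel" for A B :: "'a set"
    using that unfolding borel_prod[symmetric] by (rule pair_measureI)
  have Kb: "K \<in> sets borel" using borel_compact[OF K] .
  have G_null: "emeasure (G (L ! i)) A = 0" if "i < n" "A \<in> sets borel" "emeasure \<gamma> (E (L ! i) \<inter> A) = 0" for i A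
    using that G_em[OF that(1,2)] by (simp add: measure_def)
  have \<gamma>_null: "emeasure \<gamma> A = 0" if "A \<in> sets borel" "A \<subseteq> - (K \<times> K)" for A
  proof -
    have "emeasure \<gamma> A \<le> emeasure \<gamma> (- (K \<times> K))"
      using that \<gamma>D(2) borel_Times[OF Kb Kb] by (intro emeasure_mono) auto
    then show ?thesis using \<gamma>D(4) by simp
  qed
  have a_null: "emeasure (a (L ! i)) (- (K \<inter> ball (fst (L ! i)) r)) = 0" if "i < n" for i
  proof -
    let ?S = "- (K \<inter> ball (fst (L ! i)) r)"
    have S: "?S \<in> sets borel" using Kb by auto
    have "emeasure \<gamma> (E (L ! i) \<inter> ?S \<times> UNIV) = 0"
      using S E_open by (intro \<gamma>_null sets.Int borel_Times) (auto simp: E_def)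
    then show ?thesis using S that by (simp add: ab_em G_null borel_Times)
  qed
  have b_null: "emeasure (b (L ! i)) (- (K \<inter> ball (snd (L ! i)) r)) = 0" if "i < n" for i
  proof -
    let ?S = "- (K \<inter> ball (snd (L ! i)) r)"
    have S: "?S \<in> sets borel" using Kb by auto
    have "emeasure \<gamma> (E (L ! i) \<inter> UNIV \<times> ?S) = 0"
      using S E_open by (intro \<gamma>_null sets.Int borel_Times) (auto simp: E_def)
    then show ?thesis using S that by (simp add: ab_em G_null borel_Times)
  qed

  \<comment> \<open>Product couplings of marginals taken from consecutive pairs of the cycle\<close>
  define p where "p i = a (rotate1 L ! i) \<Otimes>\<^sub>M b (L ! i)" for i
  have rot: "\<exists>j<n. rotate1 L ! i = L ! j" if "i < n" for i
    using nth_rotate1[of i L] that n by (intro exI[of _ "Suc i mod n"]) (simp add: n_def)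
  have p_sets: "sets (p i) = sets borel" "space (p i) = UNIV" for i
    unfolding p_def sets_pair_measure_cong[OF ab_sets(1) ab_sets(3)] borel_prod
    by (simp_all add: space_pair_measure ab_sets)
  have rot_fin: "finite_measure (a (rotate1 L ! i))" and rot_1: "emeasure (a (rotate1 L ! i)) UNIV = 1"
    and rot_null: "emeasure (a (rotate1 L ! i)) (- (K \<inter> ball (fst (rotate1 L ! i)) r)) = 0"
    if "i < n" for i
    using rot[OF that] ab_fin ab_1 a_null by auto
  have p_em: "emeasure (p i) (A \<times> B) = emeasure (a (rotate1 L ! i)) A * emeasure (b (L ! i)) B"
    if "i < n" "A \<in> sets borel" "B \<in> sets borel" for i A B
  proof -
    interpret B: finite_measure "b (L ! i)" using ab_fin that by auto
    show ?thesis unfolding p_def using that by (intro B.emeasure_pair_measure_Times) (auto simp: ab_sets)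
  qed
  have p_fin: "finite_measure (p i)" if "i < n" for i
    unfolding p_def using that by (intro finite_measure_pair_measure ab_fin rot_fin)
  have p_1: "emeasure (p i) UNIV = 1" if "i < n" for i
    using p_em[OF that, of UNIV UNIV] rot_1[OF that] ab_1[OF that] by simp
  have p_AE: "AE q in p i. q \<in> (K \<inter> ball (fst (rotate1 L ! i)) r) \<times> (K \<inter> ball (snd (L ! i)) r)"
      (is "AE q in _. q \<in> ?S") if "i < n" for i
  proof (rule AE_I)
    have "emeasure (p i) (space (p i) - ?S) = 0"
      unfolding p_def using that rot_null b_null Kb
      by (intro emeasure_pair_measure_outside_Times ab_fin rot_fin)
         (auto simp: ab_sets Compl_eq_Diff_UNIV)
    then show "emeasure (p i) (- ?S) = 0" by (simp add: p_sets Compl_eq_Diff_UNIV)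
    show "- ?S \<in> sets (p i)" unfolding p_sets using Kb
      by (intro borel_comp borel_Times) auto
  qed auto

  \<comment> \<open>Replacement of a small multiple of the restrictions by the couplings\<close>
  define c where "c = Min (m ` {..<n}) / n"
  have c: "c > 0" "c \<le> m i / n" if "i < n" for i
  proof -
    have "Min (m ` {..<n}) > 0" using n m_pos by (subst Min_gr_iff) auto
    then show "c > 0" using n by (simp add: c_def)
    show "c \<le> m i / n" using that by (auto simp: c_def intro!: divide_right_mono Min_le)
  qed
  then have c0: "c > 0" using n by blast
  define scaled where "scaled M = density M (\<lambda>_. ennreal c)" for M :: "('a \<times> 'a) measure"
  have scaled_sets: "sets (scaled M) = sets M" "space (scaled M) = space M" for M
    by (simp_all add: scaled_def)
  have scaled_em: "emeasure (scaled M) A = ennreal c * emeasure M A" if "A \<in> sets M" for A M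
    using that by (simp add: scaled_def emeasure_density nn_integral_cmult_indicator)
  have scaled_int: "(LINT q|scaled M. g q) = c * (LINT q|M. g q)"
      if "g \<in> borel_measurable M" for M and g :: "_ \<Rightarrow> real"
    unfolding scaled_def using that c0 by (subst integral_density) auto
  define N1 where "N1 = sum_measure {..<n} (\<lambda>i. scaled (G (L ! i)))"
  define N2 where "N2 = sum_measure {..<n} (\<lambda>i. scaled (p i))"
  have N_sets: "sets N1 = sets borel" "sets N2 = sets borel" "space N1 = UNIV" "space N2 = UNIV"
    by (simp_all add: N1_def N2_def)
  have N1_em: "emeasure N1 A = (\<Sum>i<n. ennreal c * emeasure (G (L ! i)) A)" if "A \<in> sets borel" for A
    unfolding N1_def using that by (subst emeasure_sum_measure) (auto simp: scaled_sets scaled_em G_sets)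
  have N2_em: "emeasure N2 A = (\<Sum>i<n. ennreal c * emeasure (p i) A)" if "A \<in> sets borel" for A
    unfolding N2_def using that by (subst emeasure_sum_measure) (auto simp: scaled_sets scaled_em p_sets)
  have N_fin: "finite_measure N1" "finite_measure N2"
    by (auto intro!: finite_measureI simp: N_sets N1_em N2_em G_1 p_1 ennreal_mult_eq_top_iff)
  \<comment> \<open>The boxes may overlap, or even coincide. Dividing the smallest box mass by n in
    \<open>c\<close> makes each term take at most the share 1/n of \<open>\<gamma>\<close>, so the
    sum never removes more than is there.\<close>
  have N1_le: "emeasure N1 A \<le> emeasure \<gamma> A" if A: "A \<in> sets borel" for A
  proof -
    have "emeasure N1 A \<le> (\<Sum>i<n. ennreal (measure \<gamma> A / n))"
      unfolding N1_em[OF A]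
    proof (rule sum_mono)
      fix i assume "i \<in> {..<n}"
      then have i: "i < n" by simp
      have "c * (measure \<gamma> (E (L ! i) \<inter> A) / m i) \<le> (m i / n) * (measure \<gamma> A / m i)"
        using c[OF i] m_pos[OF i] A \<gamma>D(2)
        by (intro mult_mono divide_right_mono finite_measure_mono) auto
      also have "\<dots> = measure \<gamma> A / n" using m_pos[OF i] by simp
      finally show "ennreal c * emeasure (G (L ! i)) A \<le> ennreal (measure \<gamma> A / n)"
        unfolding G_em[OF i A] using c0 by (simp add: ennreal_mult'[symmetric] ennreal_leI)
    qed
    also have "\<dots> = emeasure \<gamma> A"
      using n by (simp add: emeasure_eq_measure ennreal_of_nat_eq_real_of_nat ennreal_mult'[symmetric])
    finally show ?thesis .
  qed
  obtain \<gamma>' where \<gamma>': "finite_measure \<gamma>'" "sets \<gamma>' = sets borel"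
    and ex: "\<And>A. A \<in> sets borel \<Longrightarrow> emeasure \<gamma>' A + emeasure N1 A = emeasure \<gamma> A + emeasure N2 A"
    using measure_exchange[OF \<gamma>D(1) N_fin \<gamma>D(2) N_sets(1,2) N1_le] by blast
  have \<gamma>'_space: "space \<gamma>' = UNIV" using sets_eq_imp_space_eq[OF \<gamma>'(2)] by simp
  have cancel: "emeasure \<gamma>' A = emeasure \<gamma> A" if "A \<in> sets borel" "emeasure N1 A = emeasure N2 A" for A
    using ex[OF that(1)] that(2) finite_measure.emeasure_finite[OF N_fin(2), of A]
    by (simp add: ennreal_add_left_cancel add.commute[of _ "emeasure N2 A"])

  \<comment> \<open>Admissibility of the modified plan\<close>
  have "\<gamma>' \<in> transport_plans K \<mu> \<nu>"
    unfolding transport_plans_def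
  proof (intro CollectI conjI \<gamma>')
    have KK: "- (K \<times> K) \<in> sets borel" using Kb by (intro borel_comp borel_Times)
    have "emeasure (p i) (- (K \<times> K)) = 0" if "i < n" for i
    proof -
      have "AE q in p i. q \<in> K \<times> K" using p_AE[OF that] by eventually_elim auto
      moreover have "{q \<in> space (p i). \<not> q \<in> K \<times> K} = - (K \<times> K)" by (auto simp: p_sets)
      ultimately show ?thesis
        using KK AE_iff_measurable[of "- (K \<times> K)" "p i" "\<lambda>q. q \<in> K \<times> K"] p_sets(1)[of i] by blast
    qed
    then have "emeasure N2 (- (K \<times> K)) = 0" using KK by (simp add: N2_em)
    then show "emeasure \<gamma>' (- (K \<times> K)) = 0"
      using ex[OF KK] \<gamma>D(4) by simp
    show "distr \<gamma>' borel fst = \<mu>"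
      unfolding \<gamma>D(5)[symmetric]
    proof (rule measure_eqI)
      fix A assume "A \<in> sets (distr \<gamma>' borel fst)"
      then have A: "A \<in> sets borel" by simp
      \<comment> \<open>The first marginals removed and added are the same list up to rotation, so
        only their sums agree; the second marginals below agree term by term.\<close>
      have "emeasure N1 (A \<times> UNIV) = (\<Sum>i<n. ennreal c * emeasure (a (L ! i)) A)"
        using A by (simp add: N1_em borel_Times ab_em)
      also have "\<dots> = (\<Sum>i<n. ennreal c * emeasure (a (rotate1 L ! i)) A)"
        unfolding n_def by (rule sum_rotate1[symmetric])
      also have "\<dots> = emeasure N2 (A \<times> UNIV)"
        using A by (simp add: N2_em borel_Times p_em ab_1)
      finally have "emeasure \<gamma>' (A \<times> UNIV) = emeasure \<gamma> (A \<times> UNIV)"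
        using A by (intro cancel borel_Times) auto
      moreover have "fst -` A = A \<times> (UNIV :: 'a set)" by auto
      ultimately show "emeasure (distr \<gamma>' borel fst) A = emeasure (distr \<gamma> borel fst) A"
        using A by (simp add: emeasure_distr fst_m \<gamma>' \<gamma>D(2,3) \<gamma>'_space)
    qed simp
    show "distr \<gamma>' borel snd = \<nu>"
      unfolding \<gamma>D(6)[symmetric]
    proof (rule measure_eqI)
      fix A assume "A \<in> sets (distr \<gamma>' borel snd)"
      then have A: "A \<in> sets borel" by simp
      have "emeasure N1 (UNIV \<times> A) = emeasure N2 (UNIV \<times> A)"
        using A by (simp add: N1_em N2_em borel_Times ab_em[symmetric] p_em rot_1)
      then have "emeasure \<gamma>' (UNIV \<times> A) = emeasure \<gamma> (UNIV \<times> A)"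
        using A by (intro cancel borel_Times) auto
      moreover have "snd -` A = (UNIV :: 'a set) \<times> A" by auto
      ultimately show "emeasure (distr \<gamma>' borel snd) A = emeasure (distr \<gamma> borel snd) A"
        using A by (simp add: emeasure_distr snd_m \<gamma>' \<gamma>D(2,3) \<gamma>'_space)
    qed simp
  qed
  from opt[OF this]
  have le: "(LINT q:K \<times> K|\<gamma>. dist (fst q) (snd q)) \<le> (LINT q:K \<times> K|\<gamma>'. dist (fst q) (snd q))"
    by (simp add: transport_cost_def case_prod_beta')

  \<comment> \<open>Comparison of the two costs\<close>
  define g where "g q = indicat_real (K \<times> K) q * dist (fst q) (snd q)" for q
  have KK: "compact (K \<times> K)" using K by (simp add: compact_Times)
  have gc: "continuous_on (K \<times> K) (\<lambda>q. dist (fst q) (snd q))" by (intro continuous_intros)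
  have gm: "g \<in> borel_measurable borel"
    using continuous_on_compact_measurable_bounded(1)[OF KK gc]
    by (simp add: g_def[abs_def] set_borel_measurable_def)
  \<comment> \<open>The cutoff in \<open>g\<close> bounds the distance on the whole product space,
    as \<open>integral_exchange\<close> requires.\<close>
  have gb: "\<bar>g q\<bar> \<le> diameter K" for q
    using diameter_bounded_bound[OF compact_imp_bounded[OF K]] diameter_ge_0[OF compact_imp_bounded[OF K]]
    by (auto simp: g_def indicator_def)
  have gi: "integrable M g" if "finite_measure M" "sets M = sets borel" for M
    using gb gm by (intro finite_measure.integrable_const_bound[OF that(1), of _ "diameter K"])
      (auto simp: measurable_cong_sets[OF that(2) refl])
  have scaled_fin: "finite_measure (scaled (G (L ! i)))" "finite_measure (scaled (p i))" if "i < n" for i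
    using G_1[OF that] p_1[OF that]
    by (auto intro!: finite_measureI simp: scaled_sets scaled_em G_sets p_sets)
  have N1_int: "(LINT q|N1. g q) = (\<Sum>i<n. c * (LINT q|G (L ! i). g q))"
    unfolding N1_def
    using gm by (subst integral_sum_measure)
      (auto simp: scaled_sets G_sets scaled_int measurable_cong_sets[OF G_sets(1) refl] scaled_fin intro!: gi)
  have N2_int: "(LINT q|N2. g q) = (\<Sum>i<n. c * (LINT q|p i. g q))"
    unfolding N2_def
    using gm by (subst integral_sum_measure)
      (auto simp: scaled_sets p_sets scaled_int measurable_cong_sets[OF p_sets(1) refl] scaled_fin intro!: gi)
  have lower: "dist (fst (L ! i)) (snd (L ! i)) - 2 * r \<le> (LINT q|G (L ! i). g q)" if i: "i < n" for i
  proof -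
    interpret Gi: finite_measure "G (L ! i)" using G_fin[OF i] .
    have "AE q in \<gamma>. q \<in> E (L ! i) \<longrightarrow> dist (fst (L ! i)) (snd (L ! i)) - 2 * r \<le> g q"
      using AE_in_Times[OF \<gamma> K]
    proof eventually_elim
      case (elim q)
      have "dist (fst (L ! i)) (snd (L ! i)) \<le>
          dist (fst (L ! i)) (fst q) + dist (fst q) (snd q) + dist (snd q) (snd (L ! i))"
        by metric
      then show ?case
        using elim by (auto simp: E_def g_def mem_Times_iff dist_commute)
    qed
    then have "AE q in G (L ! i). dist (fst (L ! i)) (snd (L ! i)) - 2 * r \<le> g q"
      unfolding G_def by (intro AE_uniform_measureI E_sets)
    then have "(LINT q|G (L ! i). dist (fst (L ! i)) (snd (L ! i)) - 2 * r) \<le> (LINT q|G (L ! i). g q)"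
      using gi[OF G_fin[OF i] G_sets(1)] by (intro integral_mono_AE) auto
    then show ?thesis using G_1[OF i] by (simp add: G_sets measure_def)
  qed
  have upper: "(LINT q|p i. g q) \<le> dist (fst (rotate1 L ! i)) (snd (L ! i)) + 2 * r" if i: "i < n" for i
  proof -
    interpret pi: finite_measure "p i" using p_fin[OF i] .
    have "AE q in p i. g q \<le> dist (fst (rotate1 L ! i)) (snd (L ! i)) + 2 * r"
      using p_AE[OF i]
    proof eventually_elim
      case (elim q)
      have "dist (fst q) (snd q) \<le> dist (fst (rotate1 L ! i)) (fst q) +
          dist (fst (rotate1 L ! i)) (snd (L ! i)) + dist (snd (L ! i)) (snd q)"
        by metric
      then show ?case
        using elim by (auto simp: g_def mem_Times_iff)
    qed
    then have "(LINT q|p i. g q) \<le> (LINT q|p i. dist (fst (rotate1 L ! i)) (snd (L ! i)) + 2 * r)"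
      using gi[OF p_fin[OF i] p_sets(1)] by (intro integral_mono_AE) auto
    then show ?thesis using p_1[OF i] by (simp add: p_sets measure_def)
  qed
  have "(LINT q|\<gamma>'. g q) + (LINT q|N1. g q) = (LINT q|\<gamma>. g q) + (LINT q|N2. g q)"
    by (rule integral_exchange[OF \<gamma>'(1) N_fin(1) \<gamma>D(1) N_fin(2) \<gamma>'(2) N_sets(1) \<gamma>D(2) N_sets(2) ex gm gb])
  moreover have "(LINT q|N1. g q) \<ge> c * (D - 2 * r * n)"
  proof -
    have "D - 2 * r * n \<le> (\<Sum>i<n. LINT q|G (L ! i). g q)"
      using sum_mono[of "{..<n}" "\<lambda>i. dist (fst (L ! i)) (snd (L ! i)) - 2 * r", OF lower]
      by (simp add: D_def sum_subtractf mult_ac)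
    then show ?thesis using c0 by (simp add: N1_int sum_distrib_left[symmetric])
  qed
  moreover have "(LINT q|N2. g q) \<le> c * (D' + 2 * r * n)"
  proof -
    have "(\<Sum>i<n. LINT q|p i. g q) \<le> D' + 2 * r * n"
      using sum_mono[of "{..<n}" _ "\<lambda>i. dist (fst (rotate1 L ! i)) (snd (L ! i)) + 2 * r", OF upper]
      by (simp add: D'_def sum.distrib mult_ac)
    then show ?thesis using c0 by (simp add: N2_int sum_distrib_left[symmetric])
  qed
  \<comment> \<open>Here the choice of \<open>r\<close> pays off: the mass added is strictly cheaper
    than the mass removed.\<close>
  moreover have "c * (D' + 2 * r * n) < c * (D - 2 * r * n)"
    using c0 r by simp
  ultimately have "(LINT q|\<gamma>'. g q) < (LINT q|\<gamma>. g q)" by linarith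
  with le show False
    by (simp add: set_lebesgue_integral_def g_def)
qed

text \<open>The marginals of a plan are the Jordan parts of \<open>f\<close>, so both integrals pull
  back to the plan along the two projections.\<close>

lemma
  fixes K :: "'a::euclidean_space set"
  assumes \<gamma>: "\<gamma> \<in> transport_plans K (pos_part f) (neg_part f)" and K: "compact K"
    and \<psi>: "continuous_on K \<psi>"
  shows signed_integral_plan:
      "signed_integral K f \<psi> = (LINT q:K \<times> K|\<gamma>. \<psi> (fst q) - \<psi> (snd q))"
    and set_integrable_plan: "set_integrable \<gamma> (K \<times> K) (\<lambda>q. \<psi> (fst q) - \<psi> (snd q))"
proof -
  note \<gamma>D = transport_plansD[OF \<gamma>]
  have KK: "compact (K \<times> K)" using K by (simp add: compact_Times)
  have i: "set_integrable \<gamma> (K \<times> K) (\<lambda>q. \<psi> (fst q))" "set_integrable \<gamma> (K \<times> K) (\<lambda>q. \<psi> (snd q))"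
    using \<psi> by (auto intro!: set_integrable_continuous_compact[OF \<gamma>D(1,2) KK] continuous_intros
        continuous_on_compose2[OF \<psi>])
  show "set_integrable \<gamma> (K \<times> K) (\<lambda>q. \<psi> (fst q) - \<psi> (snd q))"
    using i by (rule set_integral_diff)
  have \<psi>m: "(\<lambda>x. indicat_real K x *\<^sub>R \<psi> x) \<in> borel_measurable borel"
    using continuous_on_compact_measurable_bounded(1)[OF K \<psi>] by (simp add: set_borel_measurable_def)
  note AE = AE_in_Times[OF \<gamma> K]
  have proj: "(LINT x:K|distr \<gamma> borel pr. \<psi> x) = (LINT q:K \<times> K|\<gamma>. \<psi> (pr q))"
    if pr: "pr = fst \<or> pr = snd" for pr
  proof -
    have prm: "pr \<in> \<gamma> \<rightarrow>\<^sub>M borel"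
      unfolding measurable_cong_sets[OF \<gamma>D(2) refl]
      using pr by (intro borel_measurable_continuous_onI) (auto intro: continuous_intros)
    have "(LINT x:K|distr \<gamma> borel pr. \<psi> x) = (LINT q|\<gamma>. indicat_real K (pr q) *\<^sub>R \<psi> (pr q))"
      unfolding set_lebesgue_integral_def using prm \<psi>m by (rule integral_distr)
    also have "\<dots> = (LINT q:K \<times> K|\<gamma>. \<psi> (pr q))"
      unfolding set_lebesgue_integral_def
    proof (rule integral_cong_AE)
      show "(\<lambda>q. indicat_real K (pr q) *\<^sub>R \<psi> (pr q)) \<in> borel_measurable \<gamma>"
        using prm \<psi>m by (rule measurable_compose)
      show "(\<lambda>q. indicat_real (K \<times> K) q *\<^sub>R \<psi> (pr q)) \<in> borel_measurable \<gamma>"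
        using i pr by (auto simp: set_integrable_def)
      show "AE q in \<gamma>. indicat_real K (pr q) *\<^sub>R \<psi> (pr q) = indicat_real (K \<times> K) q *\<^sub>R \<psi> (pr q)"
        using AE by eventually_elim (use pr in auto)
    qed
    finally show ?thesis .
  qed
  show "signed_integral K f \<psi> = (LINT q:K \<times> K|\<gamma>. \<psi> (fst q) - \<psi> (snd q))"
    unfolding signed_integral_def \<gamma>D(5,6)[symmetric]
    using proj i by (simp add: set_integral_diff)
qed

text \<open>The gap between cost and dual value is the integral of the nonnegative slack
  \<open>u\<close>, hence it vanishes exactly when the slack is 0 almost everywhere. This equality
  case transfers saturation from the constructed potential to any maximizer.\<close>

lemma signed_integral_le_transport_cost:
  fixes K :: "'a::euclidean_space set"
  assumes \<gamma>: "\<gamma> \<in> transport_plans K (pos_part f) (neg_part f)" and K: "compact K"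
    and \<psi>: "1-lipschitz_on K \<psi>"
  shows "ereal (signed_integral K f \<psi>) \<le> transport_cost K \<gamma>"
    and "ereal (signed_integral K f \<psi>) = transport_cost K \<gamma> \<longleftrightarrow>
      (AE q in \<gamma>. \<psi> (fst q) - \<psi> (snd q) = dist (fst q) (snd q))"
proof -
  note \<gamma>D = transport_plansD[OF \<gamma>]
  have KK: "compact (K \<times> K)" using K by (simp add: compact_Times)
  have i: "set_integrable \<gamma> (K \<times> K) (\<lambda>q. dist (fst q) (snd q))"
    by (intro set_integrable_continuous_compact[OF \<gamma>D(1,2) KK] continuous_intros)
  note j = set_integrable_plan[OF \<gamma> K lipschitz_on_continuous_on[OF \<psi>]]
  note eq = signed_integral_plan[OF \<gamma> K lipschitz_on_continuous_on[OF \<psi>]]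
  have le: "\<psi> (fst q) - \<psi> (snd q) \<le> dist (fst q) (snd q)" if "q \<in> K \<times> K" for q
    using lipschitz_onD[OF \<psi>, of "fst q" "snd q"] that by (auto simp: dist_real_def)
  note AE = AE_in_Times[OF \<gamma> K]
  define u where "u q = indicat_real (K \<times> K) q *\<^sub>R (dist (fst q) (snd q) - (\<psi> (fst q) - \<psi> (snd q)))" for q
  have u: "integrable \<gamma> u" "\<And>q. 0 \<le> u q"
    using set_integral_diff(1)[OF i j] le by (auto simp: u_def[abs_def] set_integrable_def indicator_def)
  have *: "transport_cost K \<gamma> = ereal (signed_integral K f \<psi> + (LINT q|\<gamma>. u q))"
    using set_integral_diff(2)[OF i j] eq
    by (simp add: transport_cost_def case_prod_beta' u_def set_lebesgue_integral_def)
  show "ereal (signed_integral K f \<psi>) \<le> transport_cost K \<gamma>"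
    unfolding * using u(2) by simp
  have "ereal (signed_integral K f \<psi>) = transport_cost K \<gamma> \<longleftrightarrow> (AE q in \<gamma>. u q = 0)"
    unfolding * using integral_nonneg_eq_0_iff_AE[OF u(1)] u(2) by simp
  also have "\<dots> \<longleftrightarrow> (AE q in \<gamma>. \<psi> (fst q) - \<psi> (snd q) = dist (fst q) (snd q))"
  proof
    assume "AE q in \<gamma>. u q = 0"
    with AE show "AE q in \<gamma>. \<psi> (fst q) - \<psi> (snd q) = dist (fst q) (snd q)"
      by eventually_elim (simp add: u_def)
  next
    assume "AE q in \<gamma>. \<psi> (fst q) - \<psi> (snd q) = dist (fst q) (snd q)"
    with AE show "AE q in \<gamma>. u q = 0"
      by eventually_elim (simp add: u_def)
  qed
  finally show "ereal (signed_integral K f \<psi>) = transport_cost K \<gamma> \<longleftrightarrow>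
      (AE q in \<gamma>. \<psi> (fst q) - \<psi> (snd q) = dist (fst q) (snd q))" .
qed

lemma kantorovich_duality:
  fixes K :: "'a::euclidean_space set"
  assumes \<gamma>: "\<gamma> \<in> transport_plans K (pos_part f) (neg_part f)" and K: "compact K"
    and opt: "\<And>\<gamma>'. \<gamma>' \<in> transport_plans K (pos_part f) (neg_part f) \<Longrightarrow>
      transport_cost K \<gamma> \<le> transport_cost K \<gamma>'"
  obtains \<psi> where "1-lipschitz_on UNIV \<psi>" "ereal (signed_integral K f \<psi>) = transport_cost K \<gamma>"
proof -
  obtain \<psi> where \<psi>: "1-lipschitz_on UNIV \<psi>" "\<And>x y. (x, y) \<in> spt \<gamma> \<Longrightarrow> \<psi> x - \<psi> y = dist x y"
    using cyclically_monotone_potential[OF optimal_plan_cyclically_monotone[OF \<gamma> K opt]] by blast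
  note \<gamma>D = transport_plansD[OF \<gamma>]
  have "AE q in \<gamma>. q \<in> spt \<gamma>"
    using emeasure_outside_spt[OF \<gamma>D(2)] closed_spt[of \<gamma>] \<gamma>D(2)
    by (intro AE_I[of _ _ "- spt \<gamma>"]) auto
  then have "AE q in \<gamma>. \<psi> (fst q) - \<psi> (snd q) = dist (fst q) (snd q)"
    by eventually_elim (simp add: \<psi>(2))
  then have "ereal (signed_integral K f \<psi>) = transport_cost K \<gamma>"
    using signed_integral_le_transport_cost(2)[OF \<gamma> K lipschitz_on_subset[OF \<psi>(1)]] by simp
  with \<psi>(1) show thesis by (rule that)
qed

section \<open>Transport rays in an annulus\<close>

text \<open>In the parametrization of the larger segment the ends of the smaller one have parameters
  in [0, 1] at distance at least 1, so they are its two ends. Thus a ray that is longest among those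
  containing it is maximal for inclusion.\<close>

lemma closed_segment_subset_dist_eq:
  fixes a b c d :: "'a::euclidean_space"
  assumes "closed_segment a b \<subseteq> closed_segment c d" and le: "dist c d \<le> dist a b"
  shows "closed_segment c d = closed_segment a b"
proof -
  have "a \<in> closed_segment c d" "b \<in> closed_segment c d" using assms(1) by auto
  then obtain s t where a: "a = (1 - s) *\<^sub>R c + s *\<^sub>R d" and b: "b = (1 - t) *\<^sub>R c + t *\<^sub>R d"
    and st: "0 \<le> s" "s \<le> 1" "0 \<le> t" "t \<le> 1"
    by (auto simp: in_segment)
  show ?thesis
  proof (cases "c = d")
    case True
    then show ?thesis using a b by (simp add: algebra_simps)
  next
    case False
    have "a - b = (t - s) *\<^sub>R (c - d)" by (simp add: a b algebra_simps)
    then have "dist a b = \<bar>t - s\<bar> * dist c d" by (simp add: dist_norm)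
    with le False have "1 \<le> \<bar>t - s\<bar>" by simp
    then have "s = 0 \<and> t = 1 \<or> s = 1 \<and> t = 0" using st by linarith
    then show ?thesis by (auto simp: a b closed_segment_commute)
  qed
qed

text \<open>A longest ray among the compactly many ones containing a given segment is maximal.\<close>

lemma transport_ray_containing:
  fixes \<phi> :: "'a::euclidean_space \<Rightarrow> real"
  assumes P: "compact P" and N: "compact N" and \<phi>: "continuous_on (P \<union> N) \<phi>"
    and xy: "(x, y) \<in> ray_pairs \<phi> P N"
  obtains x' y' where "transport_ray \<phi> P N x' y'" "closed_segment x y \<subseteq> closed_segment x' y'"
proof -
  \<comment> \<open>Three nonnegative terms whose vanishing says that the pair satisfies the ray
    equation and that \<open>x\<close> and \<open>y\<close> lie between its ends; one continuous
    function makes \<open>R\<close> a closed preimage.\<close>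
  define F where "F q = \<bar>\<phi> (fst q) - \<phi> (snd q) - dist (fst q) (snd q)\<bar>
      + \<bar>dist (fst q) x + dist x (snd q) - dist (fst q) (snd q)\<bar>
      + \<bar>dist (fst q) y + dist y (snd q) - dist (fst q) (snd q)\<bar>" for q
  define R where "R = {q \<in> P \<times> N. F q = 0}"
  have PN: "compact (P \<times> N)" using P N by (rule compact_Times)
  have "continuous_on (P \<times> N) F"
    unfolding F_def by (intro continuous_intros continuous_on_compose2[OF \<phi>]) auto
  then have "closed R"
    unfolding R_def using compact_imp_closed[OF PN] by (rule continuous_closed_preimage_constant)
  from compact_Int_closed[OF PN this] have R: "compact R"
    by (rule back_subst[where P = compact]) (auto simp: R_def)
  have R_iff: "(x', y') \<in> R \<longleftrightarrow> (x', y') \<in> ray_pairs \<phi> P N \<and> x \<in> closed_segment x' y' \<and> y \<in> closed_segment x' y'"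
    for x' y'
  proof -
    have "F (x', y') = 0 \<longleftrightarrow> \<phi> x' - \<phi> y' = dist x' y' \<and> between (x', y') x \<and> between (x', y') y"
      unfolding F_def between by (simp add: add_nonneg_eq_0_iff) linarith
    then show ?thesis
      by (auto simp: R_def ray_pairs_def between_mem_segment)
  qed
  have "(x, y) \<in> R" using xy by (simp add: R_iff)
  then have "R \<noteq> {}" by auto
  moreover have "continuous_on R (\<lambda>q. dist (fst q) (snd q))" by (intro continuous_intros)
  ultimately obtain q where q: "q \<in> R" "\<And>q'. q' \<in> R \<Longrightarrow> dist (fst q') (snd q') \<le> dist (fst q) (snd q)"
    using continuous_attains_sup[OF R] by blast
  obtain x' y' where [simp]: "q = (x', y')" by (cases q)
  have in_R: "(x', y') \<in> ray_pairs \<phi> P N" "x \<in> closed_segment x' y'" "y \<in> closed_segment x' y'"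
    using q(1) by (simp_all add: R_iff)
  have "transport_ray \<phi> P N x' y'"
    unfolding transport_ray_def
  proof (intro conjI ballI in_R)
    fix p assume "p \<in> ray_pairs \<phi> P N"
    then obtain x'' y'' where p: "p = (x'', y'')" and ray: "(x'', y'') \<in> ray_pairs \<phi> P N"
      by (cases p) auto
    have "closed_segment x'' y'' = closed_segment x' y'"
      if "closed_segment x' y' \<subseteq> closed_segment x'' y''"
    proof -
      have "(x'', y'') \<in> R" using in_R ray that by (auto simp: R_iff)
      then have "dist x'' y'' \<le> dist x' y'" using q(2) by force
      with that show ?thesis by (rule closed_segment_subset_dist_eq)
    qed
    then show "case p of (x'', y'') \<Rightarrow> closed_segment x' y' \<subseteq> closed_segment x'' y'' \<longrightarrow>
        closed_segment x'' y'' = closed_segment x' y'"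
      by (simp add: p)
  qed
  moreover have "closed_segment x y \<subseteq> closed_segment x' y'"
    using in_R by (simp add: subset_closed_segment)
  ultimately show thesis by (rule that)
qed

text \<open>Two points of the open segment in the closure of the hole would, by strict convexity, force
  the points between them into the open hole.\<close>

lemma annulus_segment_finite_exceptions:
  fixes A B :: "'a::euclidean_space set"
  assumes A: "open A" "strictly_convex A" and B: "open B" "strictly_convex B"
    and \<Omega>: "\<Omega> = A - closure B"
    and "x \<noteq> y" and seg: "closed_segment x y \<subseteq> closure \<Omega>"
  obtains S where "finite S" "\<And>t. t \<in> {0<..<1} - S \<Longrightarrow> (1 - t) *\<^sub>R x + t *\<^sub>R y \<in> \<Omega>"
proof -
  define z where "z t = (1 - t) *\<^sub>R x + t *\<^sub>R y" for t
  define S where "S = {t \<in> {0<..<1}. z t \<in> closure B}"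
  have "s = t" if "s \<in> S" "t \<in> S" for s t
  proof (rule ccontr)
    assume "s \<noteq> t"
    have "z s - z t = (s - t) *\<^sub>R (y - x)" by (simp add: z_def algebra_simps)
    then have ne: "z s \<noteq> z t" using \<open>s \<noteq> t\<close> \<open>x \<noteq> y\<close> by force
    then have "open_segment (z s) (z t) \<subseteq> B"
      using B that interior_subset unfolding strictly_convex_def S_def by blast
    moreover have "z ((s + t) / 2) \<in> open_segment (z s) (z t)"
    proof -
      have "z ((s + t) / 2) = (1 - 1 / 2) *\<^sub>R z s + (1 / 2) *\<^sub>R z t"
        by (rule euclidean_eqI) (simp add: z_def inner_simps field_simps)
      then show ?thesis using ne unfolding in_segment by (intro conjI exI[of _ "1/2"]) auto
    qed
    ultimately have "z ((s + t) / 2) \<in> B" by blast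
    moreover have "z ((s + t) / 2) \<in> closure \<Omega>"
      using that unfolding z_def S_def
      by (intro subsetD[OF seg]) (auto simp: in_segment intro!: exI[of _ "(s + t) / 2"])
    moreover have "B \<inter> closure \<Omega> = {}"
      using open_Int_closure_eq_empty[OF B(1)] closure_subset[of B] by (auto simp: \<Omega>)
    ultimately show False by auto
  qed
  then have "finite S"
    by (metis finite.emptyI finite_insert finite_subset insertI1 subsetI)
  moreover have "z t \<in> \<Omega>" if "t \<in> {0<..<1} - S" for t
  proof -
    \<comment> \<open>Strict convexity of the outer domain lets only the two ends of the segment
      meet the outer boundary. With the single possible point in \<open>S\<close> this makes
      three.\<close>
    have "closure \<Omega> \<subseteq> closure A" by (auto simp: \<Omega> intro!: closure_mono)
    then have "open_segment x y \<subseteq> interior A"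
      using A(2) seg \<open>x \<noteq> y\<close> unfolding strictly_convex_def
      by (metis ends_in_segment(1) ends_in_segment(2) subsetD)
    moreover have "z t \<in> open_segment x y"
      using that \<open>x \<noteq> y\<close> by (auto simp: in_segment z_def)
    ultimately show ?thesis
      using that interior_subset by (auto simp: S_def \<Omega>)
  qed
  ultimately show thesis using that by (simp add: z_def)
qed

text \<open>The chain rule applies only at parameters whose point lies in \<open>\<Omega>\<close>.
  At the finitely many others continuity up to the closure suffices for the strong form of the
  fundamental theorem of calculus.\<close>

lemma C1_closure_line_integral:
  fixes \<Omega> :: "'a::euclidean_space set"
  assumes C1: "C1_closure \<Omega> \<phi> G" and seg: "closed_segment x y \<subseteq> closure \<Omega>"
    and S: "finite S" "\<And>t. t \<in> {0<..<1} - S \<Longrightarrow> (1 - t) *\<^sub>R x + t *\<^sub>R y \<in> \<Omega>"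
  shows "(LINT t:{0..1}|lborel. G ((1 - t) *\<^sub>R x + t *\<^sub>R y) \<bullet> (y - x)) = \<phi> y - \<phi> x"
proof -
  define z where "z t = (1 - t) *\<^sub>R x + t *\<^sub>R y" for t
  have z: "continuous_on {0..1} z" "z ` {0..1} \<subseteq> closure \<Omega>"
    unfolding z_def using seg by (auto intro!: continuous_intros simp: in_segment intro!: subsetD[OF seg])
  have c\<phi>: "continuous_on (closure \<Omega>) \<phi>" and cG: "continuous_on (closure \<Omega>) G"
    using C1 by (auto simp: C1_closure_def)
  have "((\<lambda>t. G (z t) \<bullet> (y - x)) has_integral (\<phi> \<circ> z) 1 - (\<phi> \<circ> z) 0) {0..1}"
  proof (rule fundamental_theorem_of_calculus_interior_strong[OF S(1)])
    fix t assume t: "t \<in> {0<..<1} - S"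
    have "(z has_vector_derivative (y - x)) (at t)"
      unfolding z_def by (auto intro!: derivative_eq_intros simp: algebra_simps)
    moreover have "(\<phi> has_derivative (\<lambda>h. h \<bullet> G (z t))) (at (z t) within z ` UNIV)"
      using C1 S(2)[OF t] unfolding C1_closure_def gderiv_def z_def
      by (blast intro: has_derivative_at_withinI)
    ultimately show "(\<phi> \<circ> z has_vector_derivative G (z t) \<bullet> (y - x)) (at t)"
      unfolding inner_commute[of "G (z t)"] by (rule vector_derivative_diff_chain_within)
  next
    show "continuous_on {0..1} (\<phi> \<circ> z)"
      unfolding o_def by (rule continuous_on_compose2[OF c\<phi> z])
  qed simp
  moreover have "continuous_on {0..1} (\<lambda>t. G (z t) \<bullet> (y - x))"
    by (intro continuous_intros continuous_on_compose2[OF cG z])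
  then have "set_integrable lborel {0..1} (\<lambda>t. G (z t) \<bullet> (y - x))"
    by (rule borel_integrable_atLeastAtMost')
  then have "(LINT t:{0..1}|lborel. G (z t) \<bullet> (y - x)) = integral {0..1} (\<lambda>t. G (z t) \<bullet> (y - x))"
    by (rule set_borel_integral_eq_integral(2))
  ultimately show ?thesis
    by (simp add: z_def integral_unique)
qed

lemma vector_integral_uminus: "vector_integral S (\<lambda>A. - v A) \<xi> = - vector_integral S v \<xi>"
  by (simp add: vector_integral_def signed_integral_def neg_part_def sum_negf[symmetric])

lemma total_variation_uminus: "total_variation S (\<lambda>A. - v A) = total_variation S v"
  by (simp add: total_variation_def)

text \<open>A marginal does not charge the complement of its own support. Rays are required to start
  and end in the supports of the two parts of \<open>f\<close>, and this supplies such ends.\<close>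

lemma AE_in_spt_marginals:
  fixes K :: "'a::euclidean_space set"
  assumes "\<gamma> \<in> transport_plans K \<mu> \<nu>"
  shows "AE q in \<gamma>. fst q \<in> spt \<mu> \<and> snd q \<in> spt \<nu>"
proof -
  note \<gamma>D = transport_plansD[OF assms]
  have *: "AE q in \<gamma>. pr q \<in> spt (distr \<gamma> borel pr)" if pr: "pr = fst \<or> pr = snd" for pr
  proof -
    have prm: "pr \<in> \<gamma> \<rightarrow>\<^sub>M borel"
      unfolding measurable_cong_sets[OF \<gamma>D(2) refl]
      using pr by (intro borel_measurable_continuous_onI) (auto intro: continuous_intros)
    have "AE x in distr \<gamma> borel pr. x \<in> spt (distr \<gamma> borel pr)"
      using emeasure_outside_spt[of "distr \<gamma> borel pr"] closed_spt[of "distr \<gamma> borel pr"]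
      by (intro AE_I[of _ _ "- spt (distr \<gamma> borel pr)"]) auto
    then show ?thesis
      using AE_distrD[OF prm] by blast
  qed
  show ?thesis
    using *[of fst] *[of snd] \<gamma>D(5,6) by simp
qed

text \<open>Along each segment the gradient integrates to \<open>\<phi> y - \<phi> x\<close>, and
  against the plan this gives minus the integral of \<open>\<phi>\<close> against \<open>f\<close>.
  The minus sign in the flow compensates for it.\<close>

lemma uminus_plan_flow_in_beckmann_flows:
  fixes A B :: "'a::euclidean_space set"
  assumes A: "open A" "bounded A" "strictly_convex A" and B: "open B" "strictly_convex B"
    and \<Omega>: "\<Omega> = A - closure B"
    and f: "f \<in> vmeasures_on (frontier \<Omega>)"
    and \<gamma>: "\<gamma> \<in> transport_plans (closure \<Omega>) (pos_part f) (neg_part f)"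
    and seg: "AE q in \<gamma>. closed_segment (fst q) (snd q) \<subseteq> closure \<Omega>"
  shows "(\<lambda>A. - plan_flow (closure \<Omega>) \<gamma> A) \<in> beckmann_flows \<Omega> f"
  unfolding beckmann_flows_def
proof (intro CollectI conjI allI impI)
  let ?K = "closure \<Omega>"
  have "bounded \<Omega>" using A(2) by (rule bounded_subset) (simp add: \<Omega>)
  then have K: "compact ?K" by simp
  show "(\<lambda>A. - plan_flow ?K \<gamma> A) \<in> vmeasures_on ?K"
    unfolding plan_flow_eq[OF \<gamma> K]
    by (intro vmeasures_on_uminus image_vmeasure_in_vmeasures_on segment_point_measurable[OF \<gamma> K]
        integrable_displacement[OF \<gamma> K] borel_compact K)
  fix \<phi> G assume C1: "C1_closure \<Omega> \<phi> G"
  have c\<phi>: "continuous_on ?K \<phi>" and cG: "continuous_on ?K G"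
    using C1 by (auto simp: C1_closure_def)
  define I where "I = (\<lambda>(x, y). LINT t:{0..1}|lborel.
           (let z = (1 - t) *\<^sub>R x + t *\<^sub>R y in (indicator ?K z *\<^sub>R G z) \<bullet> (y - x)))"
  have I_eq: "I (x, y) = \<phi> y - \<phi> x" if xy: "closed_segment x y \<subseteq> ?K" for x y
  proof -
    have "I (x, y) = (LINT t:{0..1}|lborel. G ((1 - t) *\<^sub>R x + t *\<^sub>R y) \<bullet> (y - x))"
      unfolding I_def prod.case Let_def
    proof (rule set_lebesgue_integral_cong)
      \<comment> \<open>For a segment inside the closed annulus the extension of the field by 0 is
        never reached.\<close>
      have "(1 - t) *\<^sub>R x + t *\<^sub>R y \<in> ?K" if "t \<in> {0..1}" for t
        using that by (intro subsetD[OF xy]) (auto simp: in_segment)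
      then show "\<forall>t. t \<in> {0..1} \<longrightarrow> (indicator ?K ((1 - t) *\<^sub>R x + t *\<^sub>R y) *\<^sub>R G ((1 - t) *\<^sub>R x + t *\<^sub>R y)) \<bullet> (y - x) =
          G ((1 - t) *\<^sub>R x + t *\<^sub>R y) \<bullet> (y - x)"
        by simp
    qed simp
    also have "\<dots> = \<phi> y - \<phi> x"
    proof (cases "x = y")
      case False
      then obtain S where "finite S" "\<And>t. t \<in> {0<..<1} - S \<Longrightarrow> (1 - t) *\<^sub>R x + t *\<^sub>R y \<in> \<Omega>"
        using annulus_segment_finite_exceptions[OF A(1,3) B \<Omega> False xy] by blast
      then show ?thesis by (rule C1_closure_line_integral[OF C1 xy])
    qed (simp add: set_lebesgue_integral_def)
    finally show ?thesis .
  qed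
  have "vector_integral ?K (plan_flow ?K \<gamma>) G = (LINT q:?K \<times> ?K|\<gamma>. I q)"
    using vector_integral_plan_flow[OF \<gamma> K cG] by (simp add: I_def)
  also have "\<dots> = (LINT q:?K \<times> ?K|\<gamma>. - (\<phi> (fst q) - \<phi> (snd q)))"
    unfolding set_lebesgue_integral_def
  proof (rule integral_cong_AE)
    show "(\<lambda>q. indicat_real (?K \<times> ?K) q *\<^sub>R I q) \<in> borel_measurable \<gamma>"
      using set_integrable_plan_flow[OF \<gamma> K cG] unfolding I_def set_integrable_def by auto
    show "(\<lambda>q. indicat_real (?K \<times> ?K) q *\<^sub>R - (\<phi> (fst q) - \<phi> (snd q))) \<in> borel_measurable \<gamma>"
      using set_integrable_plan[OF \<gamma> K c\<phi>] unfolding set_integrable_def scaleR_minus_right by auto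
    show "AE q in \<gamma>. indicat_real (?K \<times> ?K) q *\<^sub>R I q =
        indicat_real (?K \<times> ?K) q *\<^sub>R - (\<phi> (fst q) - \<phi> (snd q))"
      using seg
    proof eventually_elim
      case (elim q)
      then show ?case using I_eq[of "fst q" "snd q"] by simp
    qed
  qed
  also have "\<dots> = - signed_integral ?K f \<phi>"
    unfolding signed_integral_plan[OF \<gamma> K c\<phi>] set_lebesgue_integral_def scaleR_minus_right
    by (rule Bochner_Integration.integral_minus)
  also have "signed_integral ?K f \<phi> = signed_integral (frontier \<Omega>) f \<phi>"
    using continuous_on_compact_measurable_bounded(1)[OF K c\<phi>]
    by (intro signed_integral_restrict[OF f]) (auto simp: frontier_def)
  finally show "vector_integral ?K (\<lambda>A. - plan_flow ?K \<gamma> A) G = signed_integral (frontier \<Omega>) f \<phi>"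
    by (simp add: vector_integral_uminus)
qed

theorem proposition3p7:
  fixes \<Omega>p \<Omega>m \<Omega> :: "(real ^ 2) set"
    and f :: "(real ^ 2) set \<Rightarrow> real"
    and \<phi> :: "real ^ 2 \<Rightarrow> real"
    and \<gamma> :: "((real ^ 2) \<times> (real ^ 2)) measure"
  assumes "open \<Omega>p" "bounded \<Omega>p" "strictly_convex \<Omega>p"
    and "open \<Omega>m" "bounded \<Omega>m" "strictly_convex \<Omega>m"
    and "closure \<Omega>m \<subseteq> \<Omega>p"
    and "\<Omega> = \<Omega>p - closure \<Omega>m"
    and "f \<in> vmeasures_on (frontier \<Omega>)"
    and "f (frontier \<Omega>p) = 0" "f (frontier \<Omega>m) = 0"
    and "kantorovich_potential \<Omega> f \<phi>"
    and "\<And>x y. transport_ray \<phi> (spt (pos_part f)) (spt (neg_part f)) x y \<Longrightarrow>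
           closed_segment x y \<subseteq> closure \<Omega>"
    and "is_arg_min (transport_cost (closure \<Omega>))
           (\<lambda>\<gamma>. \<gamma> \<in> transport_plans (closure \<Omega>) (pos_part f) (neg_part f)) \<gamma>"
  shows "is_arg_min (total_variation (closure \<Omega>)) (\<lambda>v. v \<in> beckmann_flows \<Omega> f)
           (\<lambda>A. - plan_flow (closure \<Omega>) \<gamma> A) \<and>
         (INF v\<in>beckmann_flows \<Omega> f. total_variation (closure \<Omega>) v) =
           (SUP \<psi>\<in>Lip1 \<Omega>. ereal (signed_integral (closure \<Omega>) f \<psi>)) \<and>
         (SUP \<psi>\<in>Lip1 \<Omega>. ereal (signed_integral (closure \<Omega>) f \<psi>)) =
           (INF \<gamma>'\<in>transport_plans (closure \<Omega>) (pos_part f) (neg_part f).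
              transport_cost (closure \<Omega>) \<gamma>')"
proof -
  let ?K = "closure \<Omega>" and ?plans = "transport_plans (closure \<Omega>) (pos_part f) (neg_part f)"
  let ?w = "\<lambda>A. - plan_flow ?K \<gamma> A"
  note f = assms(9)
  have bdd: "bounded \<Omega>" using assms(2) by (rule bounded_subset) (simp add: assms(8))
  then have K: "compact ?K" by simp
  have \<gamma>: "\<gamma> \<in> ?plans" and opt: "\<And>\<gamma>'. \<gamma>' \<in> ?plans \<Longrightarrow> transport_cost ?K \<gamma> \<le> transport_cost ?K \<gamma>'"
    using assms(14) by (auto simp: is_arg_min_def not_less)
  obtain \<psi> where \<psi>: "1-lipschitz_on UNIV \<psi>" "ereal (signed_integral ?K f \<psi>) = transport_cost ?K \<gamma>"
    using kantorovich_duality[OF \<gamma> K opt] by blast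
  have \<psi>_Lip1: "\<psi> \<in> Lip1 \<Omega>"
    unfolding Lip1_def using lipschitz_on_subset[OF \<psi>(1)] by auto
  \<comment> \<open>\<open>\<phi>\<close> does at least as well as \<open>\<psi>\<close>, whose
    value is already the cost, an upper bound for all 1-Lipschitz functions. Hence
    \<open>\<phi>\<close> attains the cost too and saturates almost every pair.\<close>
  have \<phi>: "1-lipschitz_on ?K \<phi>" and "signed_integral ?K f \<psi> \<le> signed_integral ?K f \<phi>"
    using assms(12) \<psi>_Lip1 by (auto simp: kantorovich_potential_def is_arg_max_def Lip1_def not_less)
  then have "ereal (signed_integral ?K f \<phi>) = transport_cost ?K \<gamma>"
    using signed_integral_le_transport_cost(1)[OF \<gamma> K \<phi>] by (simp add: \<psi>(2)[symmetric])
  then have ray: "AE q in \<gamma>. \<phi> (fst q) - \<phi> (snd q) = dist (fst q) (snd q)"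
    using signed_integral_le_transport_cost(2)[OF \<gamma> K \<phi>] by simp
  have "spt (pos_part f) \<subseteq> frontier \<Omega>" "spt (neg_part f) \<subseteq> frontier \<Omega>"
    using emeasure_pos_part_outside[OF f, of "- frontier \<Omega>"]
      emeasure_neg_part_outside[OF f, of "- frontier \<Omega>"]
      spt_subset[OF frontier_closed, of "pos_part f" \<Omega>] spt_subset[OF frontier_closed, of "neg_part f" \<Omega>]
    by auto
  then have sub: "spt (pos_part f) \<subseteq> ?K" "spt (neg_part f) \<subseteq> ?K"
    by (auto simp: frontier_def)
  \<comment> \<open>Compactness of the supports is what guarantees a longest ray through a given
    pair.\<close>
  have cpt: "compact (spt (pos_part f))" "compact (spt (neg_part f))"
    using compact_Int_closed[OF K closed_spt[of "pos_part f"]] compact_Int_closed[OF K closed_spt[of "neg_part f"]] sub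
    by (simp_all add: Int_absorb1)
  have c\<phi>: "continuous_on (spt (pos_part f) \<union> spt (neg_part f)) \<phi>"
    using lipschitz_on_continuous_on[OF \<phi>] sub by (auto intro: continuous_on_subset)
  have "AE q in \<gamma>. closed_segment (fst q) (snd q) \<subseteq> ?K"
    using ray AE_in_spt_marginals[OF \<gamma>]
  proof eventually_elim
    case (elim q)
    then have "(fst q, snd q) \<in> ray_pairs \<phi> (spt (pos_part f)) (spt (neg_part f))"
      by (cases q) (simp add: ray_pairs_def)
    then obtain x' y' where "transport_ray \<phi> (spt (pos_part f)) (spt (neg_part f)) x' y'"
        "closed_segment (fst q) (snd q) \<subseteq> closed_segment x' y'"
      using transport_ray_containing[OF cpt c\<phi>] by blast
    then show ?case using assms(13) by blast
  qed
  then have w: "?w \<in> beckmann_flows \<Omega> f"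
    by (rule uminus_plan_flow_in_beckmann_flows[OF assms(1-4,6,8) f \<gamma>])
  have TV: "total_variation ?K ?w \<le> transport_cost ?K \<gamma>"
    unfolding total_variation_uminus by (rule total_variation_plan_flow[OF \<gamma> K])
  \<comment> \<open>The potential whose value is the cost turns weak duality into a lower bound for
    every admissible flow; together with \<open>TV\<close> this closes the chain.\<close>
  have B_ge: "transport_cost ?K \<gamma> \<le> total_variation ?K v" if "v \<in> beckmann_flows \<Omega> f" for v
    using dual_le_beckmann[OF bdd f that \<psi>_Lip1] by (simp add: \<psi>(2))
  have "is_arg_min (total_variation ?K) (\<lambda>v. v \<in> beckmann_flows \<Omega> f) ?w"
    using w TV B_ge by (force simp: is_arg_min_def not_less intro: order_trans)
  moreover have "(INF v\<in>beckmann_flows \<Omega> f. total_variation ?K v) = transport_cost ?K \<gamma>"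
    using INF_lower[OF w, of "total_variation ?K"] TV
    by (intro antisym INF_greatest B_ge) auto
  moreover have "(SUP \<psi>\<in>Lip1 \<Omega>. ereal (signed_integral ?K f \<psi>)) = transport_cost ?K \<gamma>"
  proof (rule antisym)
    show "(SUP \<psi>\<in>Lip1 \<Omega>. ereal (signed_integral ?K f \<psi>)) \<le> transport_cost ?K \<gamma>"
      by (intro SUP_least signed_integral_le_transport_cost(1)[OF \<gamma> K]) (simp add: Lip1_def)
    show "transport_cost ?K \<gamma> \<le> (SUP \<psi>\<in>Lip1 \<Omega>. ereal (signed_integral ?K f \<psi>))"
      unfolding \<psi>(2)[symmetric] using \<psi>_Lip1 by (rule SUP_upper)
  qed
  moreover have "(INF \<gamma>'\<in>?plans. transport_cost ?K \<gamma>') = transport_cost ?K \<gamma>"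
    using \<gamma> opt by (intro antisym INF_lower INF_greatest)
  ultimately show ?thesis by simp
qed

end
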